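(* Let $s\ge2$ and let $\mathcal{S}$ be a set of size $s$. For $k\in\mathbb{N}$ let $n=s^2k$, $V=\mathcal{S}^{n}_{(sk,\dots,sk)}$ and $N=|V|$. Define $W\in\mathbb{R}^{V\times V}$ by $W(\mathbf{u},\mathbf{v})=N\cdot\Pr[(x_\tau(\mathbf{a}),x_\tau(\mathbf{b}))=(\mathbf{u},\mathbf{v})]$, where $\mathbf{a},\mathbf{b}$ are chosen uniformly and independently from $\mathcal{S}^{sk}_{(k,\dots,k)}$ and $\tau:[s^2k]\to[sk]$ is an independent uniformly random $s$-to-$1$ map. Then $W$ is a symmetric random walk matrix, and there exists $\nu=\nu(s)>0$ such that $\lambda_2(W)\le 1/n^{\nu}$.
   Context: For integers $m,\ell$ with $m=s\ell$, $\mathcal{S}^m_{(\ell,\dots,\ell)}$ is the set of $\mathbf{y}\in\mathcal{S}^m$ in which each element of $\mathcal{S}$ appears exactly $\ell$ times. A map $\tau:[s^2k]\to[sk]$ is $s$-to-$1$ if every element of $[sk]$ has exactly $s$ preimages. For $\mathbf{y}\in\mathcal{S}^{sk}$, $x_\tau(\mathbf{y})\in\mathcal{S}^{s^2k}$ is defined by $x_\tau(\mathbf{y})_i=y_{\tau(i)}$. For a symmetric random walk (stochastic) matrix $W$, $\lambda_2(W)$ is the second largest eigenvalue in absolute value, i.e. $\max\{|\lambda_2|,|\lambda_N|\}$ for eigenvalues $1=\lambda_1\ge\lambda_2\ge\dots\ge\lambda_N$.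
   Formalization: The bound λ₂(W) ≤ 1/n^ν is stated for k ≥ 2 only: for k = 1 each step merely relabels letters, so the walk is disconnected and λ₂(W) = 1 for every s ≥ 2; the symmetric random walk claim covers all k ≥ 1. *)

theory Defs
  imports
    "HOL-Probability.Probability"
    "Jordan_Normal_Form.Char_Poly"
begin

text \<open>Words in \<open>S\<^sup>m\<close> are extensional functions on \<open>[m] = {1..m}\<close>.\<close>

definition balanced_words :: "'a set \<Rightarrow> nat \<Rightarrow> nat \<Rightarrow> (nat \<Rightarrow> 'a) set" where
  "balanced_words S m l =
     {y \<in> {1..m} \<rightarrow>\<^sub>E S. \<forall>c\<in>S. card {i \<in> {1..m}. y i = c} = l}"

definition to_one_maps :: "nat \<Rightarrow> nat \<Rightarrow> nat \<Rightarrow> (nat \<Rightarrow> nat) set" where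
  "to_one_maps s n m =
     {\<tau> \<in> {1..n} \<rightarrow>\<^sub>E {1..m}. \<forall>j\<in>{1..m}. card {i \<in> {1..n}. \<tau> i = j} = s}"

definition pullback_word :: "nat \<Rightarrow> (nat \<Rightarrow> nat) \<Rightarrow> (nat \<Rightarrow> 'a) \<Rightarrow> (nat \<Rightarrow> 'a)" where
  "pullback_word n \<tau> y = (\<lambda>i\<in>{1..n}. y (\<tau> i))"

definition walk_vertices :: "'a set \<Rightarrow> nat \<Rightarrow> (nat \<Rightarrow> 'a) set" where
  "walk_vertices S k = balanced_words S ((card S)\<^sup>2 * k) (card S * k)"

definition walk_pair_pmf :: "'a set \<Rightarrow> nat \<Rightarrow> ((nat \<Rightarrow> 'a) \<times> (nat \<Rightarrow> 'a)) pmf" where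
  "walk_pair_pmf S k =
     (let s = card S; n = s\<^sup>2 * k in
      map_pmf (\<lambda>(a, b, \<tau>). (pullback_word n \<tau> a, pullback_word n \<tau> b))
        (pair_pmf (pmf_of_set (balanced_words S (s * k) k))
          (pair_pmf (pmf_of_set (balanced_words S (s * k) k))
            (pmf_of_set (to_one_maps s n (s * k))))))"

definition walk_matrix :: "'a set \<Rightarrow> nat \<Rightarrow> (nat \<Rightarrow> 'a) \<Rightarrow> (nat \<Rightarrow> 'a) \<Rightarrow> real" where
  "walk_matrix S k u v =
     real (card (walk_vertices S k)) * measure_pmf.prob (walk_pair_pmf S k) {(u, v)}"

text \<open>For \<open>k = 1\<close> the words \<open>a\<close> and \<open>b\<close> are bijections onto \<open>S\<close>, so each step of the walk merely
  relabels the letters of the current word. The walk is then disconnected and has second eigenvalue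
  exactly 1, so an eigenvalue bound below 1 can only hold for \<open>k \<ge> 2\<close>.\<close>

text \<open>Real matrices with rows and columns indexed by a finite set \<open>V\<close> are functions
  \<open>'v \<Rightarrow> 'v \<Rightarrow> real\<close>, of which only the values on \<open>V \<times> V\<close> matter.\<close>

definition symmetric_random_walk_matrix :: "'v set \<Rightarrow> ('v \<Rightarrow> 'v \<Rightarrow> real) \<Rightarrow> bool" where
  "symmetric_random_walk_matrix V W \<longleftrightarrow>
     (\<forall>u\<in>V. \<forall>v\<in>V. W u v = W v u) \<and>
     (\<forall>u\<in>V. \<forall>v\<in>V. 0 \<le> W u v) \<and>
     (\<forall>u\<in>V. (\<Sum>v\<in>V. W u v) = 1)"

text \<open>The choice of enumeration of \<open>V\<close> only affects the resulting matrix up to conjugation by a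
  permutation matrix, so it does not affect the characteristic polynomial.\<close>

definition matrix_on :: "'v set \<Rightarrow> ('v \<Rightarrow> 'v \<Rightarrow> real) \<Rightarrow> real mat" where
  "matrix_on V W =
     (let xs = (SOME xs. distinct xs \<and> set xs = V)
      in Matrix.mat (card V) (card V) (\<lambda>(i, j). W (xs ! i) (xs ! j)))"

text \<open>The eigenvalues, repeated according to multiplicity and in decreasing order. The list is
  uniquely determined, and it exists whenever the characteristic polynomial splits over the reals,
  in particular for symmetric \<open>W\<close>.\<close>

definition eigenvalue_list :: "'v set \<Rightarrow> ('v \<Rightarrow> 'v \<Rightarrow> real) \<Rightarrow> real list" where
  "eigenvalue_list V W =
     (THE ls. sorted_wrt (\<ge>) ls \<and> char_poly (matrix_on V W) = (\<Prod>a\<leftarrow>ls. [:- a, 1:]))"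

text \<open>With 0-based lists, \<open>\<lambda>\<^sub>2\<close> is entry 1 and \<open>\<lambda>\<^sub>N\<close> is the last entry; meaningful only if
  \<open>V\<close> has at least two elements.\<close>

definition lambda2 :: "'v set \<Rightarrow> ('v \<Rightarrow> 'v \<Rightarrow> real) \<Rightarrow> real" where
  "lambda2 V W = max \<bar>eigenvalue_list V W ! 1\<bar> \<bar>eigenvalue_list V W ! (card V - 1)\<bar>"

end

theory Submission
  imports Defs "HOL-Combinatorics.Multiset_Permutations"
begin

text \<open>
  The symmetric group on the $n$ positions acts on $V$, transitively, and commutes with the walk. Let
  $f \neq 0$ be an eigenfunction orthogonal to the constants, with eigenvalue $\mu$, and fix a large
  constant $D$ depending only on $s$.

  Suppose the $\mu$-eigenspace contains a function antisymmetric under $w < D$ disjoint transpositions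
  but none antisymmetric under $w + 1$ of them. Maximality forces that function to depend on only $2w$
  positions. Evaluate the walk where $|f|$ is maximal: if $\tau$ separates these $2w$ positions, then
  exchanging two blocks shows that the average of $f$ over $\mathbf b$ vanishes, and $\tau$ fails to
  separate them with probability $O(D^2 s^2 / n)$. Hence $\mu = O(1/n)$.

  Otherwise some eigenfunction is antisymmetric under $D$ disjoint transpositions. Symmetrizing over pairs
  of positions with equal letters and then permuting the pairs gives about $n^D$ orthogonal
  eigenfunctions. On the other hand $W$ is, up to a part of norm $1/n$, a matrix with entries
  $n^{O(1)}/N$: the class of $\mathbf v$ with a given contingency table relative to $\mathbf u$ has total mass
  equal to the probability that $(\mathbf a, \mathbf b)$ has the corresponding table, and concatenating $s$ such
  pairs shows that a class of non-negligible mass contains at least $N / n^{O(1)}$ words. Bessel's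
  inequality then gives $(\mu - 1/n)^2 n^D \le n^{O(1)}$.

  For the finitely many remaining $k \ge 2$ a Dirichlet form estimate gives $\mu < 1$ uniformly in $S$.
\<close>

section \<open>Spectra of symmetric stochastic matrices\<close>

text \<open>Counting signs under disjoint transpositions stands in for the decomposition into
  irreducible representations of the symmetric group: functions whose patterns differ in one sign
  are orthogonal. The obstacle to a plain Hilbert-Schmidt estimate is that some entries of
  \<open>W\<close> are far too large. For v = u the class consists of u alone and has mass 1/|B|, so
  the diagonal entry is 1/|B|, exponentially larger than n^O(1)/N. Such entries sit in classes of
  tiny mass, and there are only polynomially many contingency tables, so dropping all light classes
  changes \<open>W\<close> by a matrix of small norm. What remains has squared Hilbert-Schmidt norm
  n^O(1) with an exponent depending on s only. This is why a degree \<open>D\<close> depending on s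
  only suffices: the number of sign patterns outgrows that power of n. \<open>W\<close> is positive
  semidefinite, so negative eigenvalues never have to be bounded. The low-degree case is the weaker
  one for large n, and the exponent 1/2 is a convenient choice that absorbs its constants.\<close>

lemma symmetric_stochastic_complex_eigenvalue:
  fixes w :: "nat \<Rightarrow> nat \<Rightarrow> real" and f :: "nat \<Rightarrow> complex" and a :: complex
  assumes sym: "\<And>i j. i < N \<Longrightarrow> j < N \<Longrightarrow> w i j = w j i"
    and row: "\<And>i. i < N \<Longrightarrow> (\<Sum>j<N. w i j) = 1"
    and ev: "\<And>i. i < N \<Longrightarrow> (\<Sum>j<N. w i j * f j) = a * f i + c"
    and nc: "\<exists>i<N. f i \<noteq> f 0"
  shows "a = of_real (Re a) \<and> (\<exists>h :: nat \<Rightarrow> real. (\<exists>i<N. h i \<noteq> 0) \<and> (\<Sum>i<N. h i) = 0 \<and>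
    (\<forall>i<N. (\<Sum>j<N. w i j * h j) = Re a * h i))"
proof -
  have N: "N > 0" using nc by auto
  \<comment> \<open>The hypothesis \<open>ev\<close> is an eigenvector equation modulo constants,
    which is all that an eigenvector of the quotient by the constants provides. Centring
    \<open>f\<close> turns it into a true eigenvector equation: summing over all rows, with column
    sums 1 by symmetry, forces the constant to vanish.\<close>
  define avg where "avg = (\<Sum>i<N. f i) / N"
  define g where "g i = f i - avg" for i
  have sumg: "(\<Sum>i<N. g i) = 0" using N by (simp add: g_def avg_def sum_subtractf)
  have rowc: "(\<Sum>j<N. complex_of_real (w i j)) = 1" if "i < N" for i
    using row[OF that] by (metis of_real_1 of_real_sum)
  have ev1: "(\<Sum>j<N. w i j * g j) = a * g i + (a * avg + c - avg)" if "i < N" for i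
  proof -
    have "(\<Sum>j<N. w i j * g j) = (\<Sum>j<N. w i j * f j) - (\<Sum>j<N. complex_of_real (w i j)) * avg"
      by (simp add: g_def right_diff_distrib sum_subtractf sum_distrib_right)
    then show ?thesis using ev[OF that] rowc[OF that] by (simp add: g_def algebra_simps)
  qed
  have "(\<Sum>i<N. \<Sum>j<N. w i j * g j) = (\<Sum>j<N. \<Sum>i<N. w j i * g j)"
    by (subst sum.swap) (simp add: sym)
  also have "\<dots> = (\<Sum>j<N. g j)"
    by (intro sum.cong refl) (simp add: sum_distrib_right[symmetric] rowc)
  finally have "N * (a * avg + c - avg) = 0"
    using sumg by (simp add: ev1 sum.distrib sum_distrib_left[symmetric])
  with N ev1 have evg: "(\<Sum>j<N. w i j * g j) = a * g i" if "i < N" for i using that by simp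
  have gne: "\<exists>i<N. g i \<noteq> 0" using nc N unfolding g_def by (metis eq_iff_diff_eq_0)
  let ?n = "\<Sum>i<N. (cmod (g i))\<^sup>2"
  have npos: "?n > 0"
  proof -
    obtain i where "i < N" "g i \<noteq> 0" using gne by blast
    then show ?thesis by (intro sum_pos2[of _ i]) auto
  qed
  let ?q = "\<Sum>i<N. \<Sum>j<N. cnj (g i) * w i j * g j"
  have q: "?q = a * of_real ?n"
  proof -
    have "?q = (\<Sum>i<N. cnj (g i) * (a * g i))"
      by (intro sum.cong refl) (simp add: evg[symmetric] sum_distrib_left mult.assoc)
    also have "\<dots> = (\<Sum>i<N. a * of_real ((cmod (g i))\<^sup>2))"
      by (intro sum.cong refl) (simp only: complex_norm_square, simp add: mult_ac)
    finally show ?thesis by (simp add: sum_distrib_left)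
  qed
  \<comment> \<open>The Hermitian form of a real symmetric matrix is real, hence so is
    \<open>a\<close>. The real and imaginary parts of \<open>g\<close> then satisfy the same
    equation, and one of them is nonzero.\<close>
  have "cnj ?q = ?q"
    by (subst (2) sum.swap) (simp add: sym mult_ac)
  then have "cnj a * of_real ?n = a * of_real ?n"
    unfolding q by simp
  then have "cnj a = a" using npos
    by (metis mult_right_cancel of_real_eq_0_iff less_irrefl)
  then have a: "a = of_real (Re a)" by (simp add: complex_eq_iff)
  have ima: "Im a = 0" using a by (metis Im_complex_of_real)
  have re: "(\<Sum>j<N. w i j * Re (g j)) = Re a * Re (g i)"
    and im: "(\<Sum>j<N. w i j * Im (g j)) = Re a * Im (g i)" if "i < N" for i
    using arg_cong[OF evg[OF that], of Re] arg_cong[OF evg[OF that], of Im] ima by simp_all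
  have "(\<exists>i<N. Re (g i) \<noteq> 0) \<or> (\<exists>i<N. Im (g i) \<noteq> 0)"
    using gne by (metis complex_eq_iff zero_complex.sel)
  then have "\<exists>h :: nat \<Rightarrow> real. (\<exists>i<N. h i \<noteq> 0) \<and> (\<Sum>i<N. h i) = 0 \<and>
    (\<forall>i<N. (\<Sum>j<N. w i j * h j) = Re a * h i)"
  proof
    assume "\<exists>i<N. Re (g i) \<noteq> 0"
    then show ?thesis using re arg_cong[OF sumg, of Re] by (intro exI[of _ "\<lambda>i. Re (g i)"]) simp
  next
    assume "\<exists>i<N. Im (g i) \<noteq> 0"
    then show ?thesis using im arg_cong[OF sumg, of Im] by (intro exI[of _ "\<lambda>i. Im (g i)"]) simp
  qed
  with a show ?thesis by (rule conjI)
qed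

lemma sum_pick:
  fixes g :: "nat \<Rightarrow> 'b::comm_ring_1"
  assumes "i < N"
  shows "(\<Sum>l<N. (if l = 0 \<or> i = l then 1 else 0) * g l) = (if i = 0 then g 0 else g 0 + g i)"
proof -
  have "(\<Sum>l<N. (if l = 0 \<or> i = l then 1 else 0) * g l) = (\<Sum>l\<in>{0, i}. g l)"
    using assms by (intro sum.mono_neutral_cong_right) auto
  then show ?thesis by auto
qed

text \<open>Conjugating by the matrix with columns $1, e_1, e_2, \dots$ splits off the constant eigenvector.\<close>
lemma char_poly_stochastic:
  fixes w :: "nat \<Rightarrow> nat \<Rightarrow> 'b::field"
  assumes N: "N = Suc n" and row: "\<And>i. i < N \<Longrightarrow> (\<Sum>j<N. w i j) = 1"
  shows "char_poly (mat N N (\<lambda>(i, j). w i j)) =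
    [:-1, 1:] * char_poly (mat n n (\<lambda>(i, j). w (Suc i) (Suc j) - w 0 (Suc j)))"
proof -
  let ?A = "mat N N (\<lambda>(i, j). w i j)"
  let ?A1 = "mat 1 1 (\<lambda>_. 1) :: 'b mat" and ?A2 = "mat 1 n (\<lambda>(i, j). w 0 (Suc j))"
  let ?A3 = "mat n n (\<lambda>(i, j). w (Suc i) (Suc j) - w 0 (Suc j))"
  let ?F = "four_block_mat ?A1 ?A2 (0\<^sub>m n 1) ?A3"
  define P :: "'b mat" where "P = mat N N (\<lambda>(i, j). if j = 0 \<or> i = j then 1 else 0)"
  define Q :: "'b mat" where "Q = mat N N (\<lambda>(i, j). if i = j then 1 else if j = 0 then -1 else 0)"
  have A: "?A \<in> carrier_mat N N" and P: "P \<in> carrier_mat N N" and Q: "Q \<in> carrier_mat N N"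
    and F: "?F \<in> carrier_mat N N"
    by (auto simp: P_def Q_def N)
  have Pm: "(P * X) $$ (i, j) = (if i = 0 then X $$ (0, j) else X $$ (0, j) + X $$ (i, j))"
    if "X \<in> carrier_mat N N" "i < N" "j < N" for X i j
  proof -
    have "(P * X) $$ (i, j) = (\<Sum>l<N. (if l = 0 \<or> i = l then 1 else 0) * X $$ (l, j))"
      using that by (simp add: P_def scalar_prod_def atLeast0LessThan)
    then show ?thesis unfolding sum_pick[OF that(2)] .
  qed
  have PQ: "P * Q = 1\<^sub>m N"
  proof (rule eq_matI)
    fix i j assume "i < dim_row (1\<^sub>m N :: 'b mat)" "j < dim_col (1\<^sub>m N :: 'b mat)"
    then have ij: "i < N" "j < N" by auto
    show "(P * Q) $$ (i, j) = 1\<^sub>m N $$ (i, j)"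
      unfolding Pm[OF Q ij] using ij N by (auto simp: Q_def)
  qed (auto simp: P_def Q_def)
  have QP: "Q * P = 1\<^sub>m N"
    using mat_mult_left_right_inverse[OF P Q PQ] .
  have AP: "?A * P = P * ?F"
  proof (rule eq_matI)
    fix i j assume "i < dim_row (P * ?F)" "j < dim_col (P * ?F)"
    then have ij: "i < N" "j < N" using P F by auto
    have "(?A * P) $$ (i, j) = (\<Sum>l<N. w i l * (if j = 0 \<or> l = j then 1 else 0))"
      using ij by (simp add: P_def scalar_prod_def atLeast0LessThan)
    also have "\<dots> = (if j = 0 then 1 else w i j)"
      using ij row[of i] by (auto simp: if_distrib cong: if_cong)
    also have "\<dots> = (P * ?F) $$ (i, j)"
      unfolding Pm[OF F ij] using ij N by (cases i; cases j) auto
    finally show "(?A * P) $$ (i, j) = (P * ?F) $$ (i, j)" .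
  qed (auto simp: P_def N)
  have "?A = ?A * (P * Q)" using A PQ by simp
  also have "\<dots> = P * ?F * Q" using assoc_mult_mat[OF A P Q] AP by simp
  finally have "similar_mat ?A ?F"
    using A P Q F PQ QP by (intro similar_matI[of _ _ P Q N]) auto
  then have "char_poly ?A = char_poly ?F" by (rule char_poly_similar)
  also have "\<dots> = char_poly ?A1 * char_poly ?A3"
    by (rule char_poly_four_block_zeros_col) auto
  also have "char_poly ?A1 = [:-1, 1:]"
    by (simp add: char_poly_defs det_def sign_def)
  finally show ?thesis .
qed

text \<open>Supplies the uniqueness required by the definite description in
  \<open>eigenvalue_list\<close>: the roots with multiplicity are determined by the
  polynomial.\<close>

lemma mset_eq_of_linear_factors_eq:
  fixes as bs :: "'b::idom list"
  assumes "(\<Prod>a\<leftarrow>as. [:- a, 1:]) = (\<Prod>a\<leftarrow>bs. [:- a, 1:])"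
  shows "mset as = mset bs"
proof -
  have "proots (\<Prod>a\<leftarrow>as. [:- a, 1:]) = mset as" for as :: "'b list"
  proof (induction as)
    case (Cons a as)
    have "(\<Prod>a\<leftarrow>as. [:- a, 1:]) \<noteq> 0" by (auto simp: prod_list_zero_iff)
    then show ?case using Cons by (simp add: proots_mult del: mult_pCons_left)
  qed simp
  then show ?thesis using assms by metis
qed

text \<open>Splitting off the constant vector leaves one factor X - 1 and the characteristic
  polynomial of the quotient. Each root of the latter comes from a zero-sum eigenvector, so it is
  real and bounded by \<beta>. A further eigenvalue 1 is thereby excluded without any discussion of
  multiplicities.\<close>

lemma lambda2_le:
  assumes fin: "finite V" and card: "card V \<ge> 2" and W: "symmetric_random_walk_matrix V W"
    and \<beta>: "\<beta> < 1"
    and bound: "\<And>\<mu> f. \<exists>u\<in>V. f u \<noteq> 0 \<Longrightarrow> (\<And>u. u \<in> V \<Longrightarrow> (\<Sum>v\<in>V. W u v * f v) = \<mu> * f u)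
      \<Longrightarrow> (\<Sum>u\<in>V. f u) = 0 \<Longrightarrow> \<bar>\<mu>\<bar> \<le> \<beta>"
  shows "lambda2 V W \<le> \<beta>"
proof -
  define xs where "xs = (SOME xs. distinct xs \<and> set xs = V)"
  have xs: "distinct xs" "set xs = V"
    using someI_ex[of "\<lambda>xs. distinct xs \<and> set xs = V"] finite_distinct_list[OF fin] unfolding xs_def by blast+
  define N where "N = card V"
  obtain n where N: "N = Suc n" using card unfolding N_def by (cases "card V") auto
  have len: "length xs = N" using xs distinct_card unfolding N_def by fastforce
  define w where "w i j = W (xs ! i) (xs ! j)" for i j
  have bij: "bij_betw (\<lambda>i. xs ! i) {..<N} V"
    using bij_betw_nth[OF xs(1)] xs(2) len by blast
  have sum: "(\<Sum>v\<in>V. F v) = (\<Sum>i<N. F (xs ! i))" for F :: "'a \<Rightarrow> real"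
    by (rule sum.reindex_bij_betw[OF bij, symmetric])
  have inV: "xs ! i \<in> V" if "i < N" for i using that len xs(2) nth_mem by metis
  have sym: "w i j = w j i" if "i < N" "j < N" for i j
    using W inV that unfolding symmetric_random_walk_matrix_def w_def by blast
  have row: "(\<Sum>j<N. w i j) = 1" if "i < N" for i
    using W inV[OF that] sum[of "W (xs ! i)"] unfolding symmetric_random_walk_matrix_def w_def by metis
  have A: "matrix_on V W = mat N N (\<lambda>(i, j). w i j)"
    unfolding matrix_on_def Let_def xs_def[symmetric] w_def N_def ..
  let ?A3 = "mat n n (\<lambda>(i, j). w (Suc i) (Suc j) - w 0 (Suc j))"
  have cp: "char_poly (matrix_on V W) = [:-1, 1:] * char_poly ?A3"
    unfolding A by (rule char_poly_stochastic[OF N row])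
  let ?C = "map_mat complex_of_real ?A3"
  have A3: "?A3 \<in> carrier_mat n n" and C: "?C \<in> carrier_mat n n" by auto
  obtain as where as: "char_poly ?C = (\<Prod>a\<leftarrow>as. [:- a, 1:])" "length as = n"
    using char_poly_factorized[OF C] by blast
  have real_root: "a = of_real (Re a) \<and> \<bar>Re a\<bar> \<le> \<beta>" if "a \<in> set as" for a
  proof -
    have "poly (char_poly ?C) a = 0"
      using that unfolding as(1) poly_prod_list by (auto simp: prod_list_zero_iff)
    then have "eigenvalue ?C a" using eigenvalue_root_char_poly[OF C] by simp
    then obtain y where y: "y \<in> carrier_vec n" "y \<noteq> 0\<^sub>v n" "?C *\<^sub>v y = a \<cdot>\<^sub>v y"
      unfolding eigenvalue_def eigenvector_def by auto
    \<comment> \<open>The quotient vector is represented modulo constants by the function that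
      vanishes at index 0.\<close>
    define f where "f i = (case i of 0 \<Rightarrow> 0 | Suc j \<Rightarrow> y $ j)" for i
    have split: "(\<Sum>j<N. F j) = F 0 + (\<Sum>j<n. F (Suc j))" for F :: "nat \<Rightarrow> complex"
      unfolding N by (rule sum.lessThan_Suc_shift)
    have ev: "(\<Sum>j<N. w i j * f j) = a * f i + (\<Sum>j<N. w 0 j * f j)" if "i < N" for i
    proof (cases i)
      case 0 then show ?thesis by (simp add: f_def)
    next
      case (Suc l)
      then have l: "l < n" using that N by simp
      have "(?C *\<^sub>v y) $ l = (a \<cdot>\<^sub>v y) $ l" using y(3) by simp
      then have "(\<Sum>j<n. (w (Suc l) (Suc j) - w 0 (Suc j)) * y $ j) = a * y $ l"
        using l y(1) by (simp add: scalar_prod_def atLeast0LessThan)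
      then show ?thesis unfolding split Suc
        by (simp add: f_def left_diff_distrib sum_subtractf algebra_simps)
    qed
    have nc: "\<exists>i<N. f i \<noteq> f 0"
    proof (rule ccontr)
      assume "\<not> ?thesis"
      then have "y $ j = 0" if "j < n" for j using that N unfolding f_def by (force dest: spec[of _ "Suc j"])
      then show False using y(1,2) by auto
    qed
    have a: "a = of_real (Re a)"
      using symmetric_stochastic_complex_eigenvalue[OF sym row ev nc] by (rule conjunct1)
    obtain h where h: "\<exists>i<N. h i \<noteq> 0" "(\<Sum>i<N. h i) = 0"
      "\<And>i. i < N \<Longrightarrow> (\<Sum>j<N. w i j * h j) = Re a * h i"
      using conjunct2[OF symmetric_stochastic_complex_eigenvalue[OF sym row ev nc]] by blast
    define H where "H v = h (the_inv_into {..<N} (\<lambda>i. xs ! i) v)" for v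
    have H: "H (xs ! i) = h i" if "i < N" for i
      unfolding H_def using the_inv_into_f_f[OF bij_betw_imp_inj_on[OF bij]] that by simp
    have "\<bar>Re a\<bar> \<le> \<beta>"
    proof (rule bound[of H])
      show "\<exists>u\<in>V. H u \<noteq> 0" using h(1) H inV by metis
      show "(\<Sum>u\<in>V. H u) = 0" unfolding sum using h(2) H by simp
      fix u assume "u \<in> V"
      then obtain i where i: "i < N" "u = xs ! i" using bij unfolding bij_betw_def by auto
      show "(\<Sum>v\<in>V. W u v * H v) = Re a * H u"
        unfolding sum i(2) using h(3)[OF i(1)] H i(1) by (simp add: w_def)
    qed
    with a show ?thesis by (rule conjI)
  qed
  interpret of_real_poly: map_poly_inj_idom_hom complex_of_real ..
  define rs where "rs = rev (sort (map Re as))"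
  have "map_poly complex_of_real (char_poly ?A3) = (\<Prod>a\<leftarrow>as. [:- a, 1:])"
    using of_real_hom.char_poly_hom[OF A3, where 'a = complex] as(1) by simp
  also have "as = map complex_of_real (map Re as)"
    using real_root by (simp add: map_idI)
  also have "(\<Prod>a\<leftarrow>map complex_of_real (map Re as). [:- a, 1:]) =
    map_poly complex_of_real (\<Prod>a\<leftarrow>map Re as. [:- a, 1:])"
    by (simp add: of_real_poly.hom_prod_list o_def)
  finally have "char_poly ?A3 = (\<Prod>a\<leftarrow>map Re as. [:- a, 1:])"
    by (simp only: of_real_poly.eq_iff)
  also have "\<dots> = (\<Prod>a\<leftarrow>rs. [:- a, 1:])"
    unfolding prod_mset_prod_list[symmetric] mset_map rs_def by simp
  finally have cpA: "char_poly (matrix_on V W) = (\<Prod>a\<leftarrow>1 # rs. [:- a, 1:])"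
    unfolding cp by simp
  have rs: "\<bar>a\<bar> \<le> \<beta>" if "a \<in> set rs" for a using that real_root unfolding rs_def by auto
  \<comment> \<open>As \<beta> < 1, the eigenvalue 1 heads the decreasing list, and the entries that
    \<open>lambda2\<close> reads all belong to \<open>rs\<close>.\<close>
  have sorted: "sorted_wrt (\<ge>) (1 # rs)"
    using rs \<beta> unfolding rs_def by (force simp: sorted_wrt_rev)
  have uniq: "ls = ls'" if "sorted_wrt (\<ge>) ls" "sorted_wrt (\<ge>) ls'" "mset ls = mset ls'" for ls ls' :: "real list"
  proof -
    have "sorted (rev ls)" "sorted (rev ls')" using that by (auto simp: sorted_wrt_rev)
    then have "rev ls = rev ls'" using that(3) by (metis mset_rev properties_for_sort)
    then show ?thesis by simp
  qed
  have "eigenvalue_list V W = 1 # rs"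
    unfolding eigenvalue_list_def
  proof (rule the_equality)
    fix ls assume ls: "sorted_wrt (\<ge>) ls \<and> char_poly (matrix_on V W) = (\<Prod>a\<leftarrow>ls. [:- a, 1:])"
    then have "mset ls = mset (1 # rs)" using cpA mset_eq_of_linear_factors_eq by metis
    then show "ls = 1 # rs" using uniq ls sorted by blast
  qed (use sorted cpA in blast)
  moreover have "length rs = n" unfolding rs_def using as(2) by simp
  ultimately show ?thesis
    using card rs N unfolding lambda2_def N_def by (auto simp: nth_Cons')
qed

section \<open>Balanced words\<close>

lemma count_image_mset_mset_set:
  assumes "finite A"
  shows "count (image_mset f (mset_set A)) c = card {i \<in> A. f i = c}"
proof -
  have "{x. x \<in> A \<and> f x = c} = {i \<in> A. c = f i}" by auto
  then show ?thesis using assms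
    by (simp add: count_image_mset vimage_def Int_def Collect_conj_eq[symmetric] conj_commute)
qed

text \<open>The common source of all transitivity statements: it is applied to words, to pairs of
  words read as words over pairs of letters, and to indicator functions of subsets.\<close>

lemma equal_fibre_cards_permute:
  assumes "finite A" "\<And>c. card {i \<in> A. f i = c} = card {i \<in> A. g i = c}"
  obtains p where "p permutes A" "\<forall>i\<in>A. f i = g (p i)"
proof -
  have "image_mset f (mset_set A) = image_mset g (mset_set A)"
    by (rule multiset_eqI) (simp add: count_image_mset_mset_set assms)
  with image_mset_eq_implies_permutes[OF assms(1) this] that show thesis by blast
qed

lemma card_fibres_comp_permutes:
  assumes "p permutes A"
  shows "card {i \<in> A. P (p i)} = card {i \<in> A. P i}"
proof -
  have "bij_betw p {i \<in> A. P (p i)} {i \<in> A. P i}"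
    using assms by (intro bij_betwI[where g = "inv_into UNIV p"])
      (auto simp: permutes_in_image permutes_inverses permutes_in_image[OF permutes_inv])
  then show ?thesis by (rule bij_betw_same_card)
qed

lemma finite_balanced_words: "finite S \<Longrightarrow> finite (balanced_words S m l)"
  unfolding balanced_words_def by (rule finite_subset[of _ "{1..m} \<rightarrow>\<^sub>E S"]) (auto intro: finite_PiE)

text \<open>The multinomial coefficient, obtained from the orderings of a multiset with
  \<open>t c\<close> copies of each letter and multiplied out to stay within the naturals. Positions
  start at 1 and list indices at 0, hence the shifts by one.\<close>

lemma card_words_of_type:
  assumes S: "finite S" and t: "(\<Sum>c\<in>S. t c) = m"
  shows "card {y \<in> {1..m} \<rightarrow>\<^sub>E S. \<forall>c\<in>S. card {i \<in> {1..m}. y i = c} = t c} * (\<Prod>c\<in>S. fact (t c)) = fact m"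
proof -
  define X where "X = (\<Sum>c\<in>S. replicate_mset (t c) c)"
  let ?Y = "{y \<in> {1..m} \<rightarrow>\<^sub>E S. \<forall>c\<in>S. card {i \<in> {1..m}. y i = c} = t c}"
  have cnt: "count X c = (if c \<in> S then t c else 0)" for c
    using S unfolding X_def by (simp add: count_sum)
  have sz: "size X = m" unfolding X_def by (simp add: t)
  have idx: "card {i \<in> {1..m}. xs ! (i - 1) = c} = count (mset xs) c" if "length xs = m" for xs :: "'a list" and c
  proof -
    have "bij_betw (\<lambda>i. i - 1) {i \<in> {1..m}. xs ! (i - 1) = c} {i. i < length xs \<and> xs ! i = c}"
      by (rule bij_betwI[where g = Suc]) (auto simp: that)
    then have "card {i \<in> {1..m}. xs ! (i - 1) = c} = card {i. i < length xs \<and> xs ! i = c}"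
      by (rule bij_betw_same_card)
    also have "\<dots> = count (mset xs) c"
      by (simp add: count_mset count_list_eq_length_filter length_filter_conv_card eq_commute)
    finally show ?thesis .
  qed
  have "bij_betw (\<lambda>xs. \<lambda>i\<in>{1..m}. xs ! (i - 1)) (permutations_of_multiset X) ?Y"
  proof (rule bij_betwI[where g = "\<lambda>y. map y [1..<Suc m]"], goal_cases)
    case 1
    show ?case
    proof (rule funcsetI)
      fix xs assume "xs \<in> permutations_of_multiset X"
      then have xs: "mset xs = X" by (simp add: permutations_of_multiset_def)
      then have len: "length xs = m" using sz by (metis size_mset)
      have "set xs \<subseteq> S" using cnt unfolding set_mset_mset[symmetric] xs by (metis count_eq_zero_iff subsetI)
      then have "(\<lambda>i\<in>{1..m}. xs ! (i - 1)) \<in> {1..m} \<rightarrow>\<^sub>E S"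
        using len by (auto intro!: subsetD[OF _ nth_mem])
      moreover have "{i \<in> {1..m}. (\<lambda>i\<in>{1..m}. xs ! (i - 1)) i = c} = {i \<in> {1..m}. xs ! (i - 1) = c}" for c by auto
      ultimately show "(\<lambda>i\<in>{1..m}. xs ! (i - 1)) \<in> ?Y" using idx[OF len] xs cnt by simp
    qed
  next
    case 2
    show ?case
    proof (rule funcsetI)
      fix y assume y: "y \<in> ?Y"
      let ?xs = "map y [1..<Suc m]"
      have "count (mset ?xs) c = count X c" for c
      proof -
        have "count (mset ?xs) c = card {i \<in> {1..m}. ?xs ! (i - 1) = c}" by (rule idx[symmetric]) simp
        also have "{i \<in> {1..m}. ?xs ! (i - 1) = c} = {i \<in> {1..m}. y i = c}"
          by (auto simp del: upt_Suc)
        also have "card \<dots> = count X c"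
        proof (cases "c \<in> S")
          case False
          then have "{i \<in> {1..m}. y i = c} = {}" using y by auto
          then show ?thesis using False cnt by (metis card.empty)
        qed (use y cnt in auto)
        finally show ?thesis .
      qed
      then show "?xs \<in> permutations_of_multiset X" by (auto simp: permutations_of_multiset_def multiset_eq_iff)
    qed
  next
    case (3 xs)
    then have "length xs = m" using sz by (metis mem_Collect_eq permutations_of_multiset_def size_mset)
    then show ?case by (intro nth_equalityI) (auto simp del: upt_Suc)
  next
    case (4 y)
    then show ?case by (auto simp: fun_eq_iff PiE_iff extensional_def simp del: upt_Suc)
  qed
  then have "card ?Y = card (permutations_of_multiset X)" by (rule bij_betw_same_card[symmetric])
  moreover have "(\<Prod>c\<in>set_mset X. fact (count X c)) = (\<Prod>c\<in>S. fact (t c) :: nat)"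
  proof (rule prod.mono_neutral_cong_left[OF S])
    show sub: "set_mset X \<subseteq> S" using cnt by (metis count_eq_zero_iff subsetI)
    show "\<forall>c\<in>S - set_mset X. fact (t c) = (1::nat)"
      using cnt by (metis DiffD1 DiffD2 count_eq_zero_iff fact_0)
    show "fact (count X c) = (fact (t c) :: nat)" if "c \<in># X" for c using that sub cnt by auto
  qed
  ultimately show ?thesis using card_permutations_of_multiset_aux[of X] sz by simp
qed

lemma balanced_words_nonempty:
  assumes "finite S"
  shows "balanced_words S (card S * l) l \<noteq> {}"
proof -
  have "card (balanced_words S (card S * l) l) * (\<Prod>c\<in>S. fact l) = fact (card S * l)"
    using card_words_of_type[OF assms, of "\<lambda>_. l"] unfolding balanced_words_def by simp
  then show ?thesis by (metis card.empty fact_nonzero mult_0)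
qed

section \<open>Permutations of positions acting on balanced words\<close>

lemma balanced_words_comp_permutes:
  assumes "y \<in> balanced_words S m l" "p permutes {1..m}"
  shows "y \<circ> p \<in> balanced_words S m l"
  using assms card_fibres_comp_permutes[OF assms(2), of "\<lambda>i. y i = c" for c]
  unfolding balanced_words_def
  by (auto simp: PiE_iff permutes_in_image extensional_def permutes_not_in)
    (metis permutes_in_image permutes_not_in atLeastAtMost_iff)

text \<open>An s-to-1 map is a balanced word over the alphabet {1..m}, so finiteness, existence and
  closure under permutations carry over from words.\<close>

lemma to_one_maps_eq_balanced_words: "to_one_maps s n m = balanced_words {1..m} n s"
  unfolding to_one_maps_def balanced_words_def ..

lemma balanced_words_transitive:
  assumes "u \<in> balanced_words S m l" "v \<in> balanced_words S m l"
  obtains p where "p permutes {1..m}" "u = v \<circ> p"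
proof -
  have "card {i \<in> {1..m}. u i = c} = card {i \<in> {1..m}. v i = c}" for c
  proof (cases "c \<in> S")
    case False
    then have "{i \<in> {1..m}. u i = c} = {}" "{i \<in> {1..m}. v i = c} = {}"
      using assms unfolding balanced_words_def by (auto simp: PiE_iff)
    then show ?thesis by metis
  next
    case True
    then have "card {i \<in> {1..m}. u i = c} = l" "card {i \<in> {1..m}. v i = c} = l"
      using assms unfolding balanced_words_def by blast+
    then show ?thesis by simp
  qed
  then obtain p where p: "p permutes {1..m}" "\<forall>i\<in>{1..m}. u i = v (p i)"
    using equal_fibre_cards_permute[of "{1..m}" u v] by auto
  have "u = v \<circ> p"
  proof
    fix i show "u i = (v \<circ> p) i"
    proof (cases "i \<in> {1..m}")
      case False
      then show ?thesis using assms p(1) unfolding balanced_words_def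
        by (auto simp: PiE_iff extensional_def permutes_not_in)
    qed (use p in auto)
  qed
  with p that show thesis by blast
qed

lemma bij_betw_comp_permutes:
  assumes p: "p permutes A" and closed: "\<And>u q. u \<in> X \<Longrightarrow> q permutes A \<Longrightarrow> u \<circ> q \<in> X"
  shows "bij_betw (\<lambda>u. u \<circ> p) X X"
  by (rule bij_betwI[where g = "\<lambda>u. u \<circ> inv_into UNIV p"])
    (auto simp: o_assoc[symmetric] permutes_inv_o[OF p] intro: closed p permutes_inv)

lemma pair_pmf_of_set:
  assumes "finite A" "A \<noteq> {}" "finite B" "B \<noteq> {}"
  shows "pair_pmf (pmf_of_set A) (pmf_of_set B) = pmf_of_set (A \<times> B)"
proof (rule pmf_eqI)
  fix z
  show "pmf (pair_pmf (pmf_of_set A) (pmf_of_set B)) z = pmf (pmf_of_set (A \<times> B)) z"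
    using assms by (cases z) (simp add: pmf_pair indicator_def card_cartesian_product)
qed

lemma sum_swap2: "(\<Sum>v\<in>A. \<Sum>t\<in>B. \<Sum>a\<in>C. F v t a) = (\<Sum>t\<in>B. \<Sum>a\<in>C. \<Sum>v\<in>A. F v t a)"
  by (subst sum.swap) (intro sum.cong refl sum.swap)

section \<open>The walk and its symmetries\<close>

locale balanced_walk =
  fixes S :: "'a set" and s k n m :: nat
  assumes card_S: "card S = s" and s_ge: "2 \<le> s" and k_ge: "1 \<le> k"
    and n_def: "n = s\<^sup>2 * k" and m_def: "m = s * k"
begin

abbreviation "B \<equiv> balanced_words S m k"
abbreviation "V \<equiv> walk_vertices S k"
abbreviation "T \<equiv> to_one_maps s n m"
abbreviation "W \<equiv> walk_matrix S k"
abbreviation "pb \<equiv> pullback_word n"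

text \<open>The contribution of a single triple (\<tau>, a, b) to an entry: N times its
  probability.\<close>

definition step_weight :: real where "step_weight = real (card V) / (real (card B) ^ 2 * real (card T))"

lemma V_eq: "V = balanced_words S n m"
  unfolding walk_vertices_def n_def m_def card_S ..

lemma finite_S: "finite S"
  using card_S s_ge card.infinite by fastforce

lemma n_eq: "n = s * m" unfolding n_def m_def by (simp add: power2_eq_square)

lemma n_pos: "n > 0" and m_pos: "m > 0"
  using s_ge k_ge unfolding n_def m_def by auto

lemma finite_V: "finite V" and finite_B: "finite B" and finite_T: "finite T"
  unfolding V_eq to_one_maps_eq_balanced_words using finite_S by (auto intro: finite_balanced_words)

lemma V_ne: "V \<noteq> {}" unfolding V_eq using balanced_words_nonempty[OF finite_S, of m]
  by (simp add: card_S n_eq)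
lemma B_ne: "B \<noteq> {}" using balanced_words_nonempty[OF finite_S, of k] by (simp add: card_S m_def)
lemma T_ne: "T \<noteq> {}" unfolding to_one_maps_eq_balanced_words
  using balanced_words_nonempty[of "{1..m}" s] by (simp add: n_eq mult.commute)

lemma card_V_pos: "card V > 0" and card_B_pos: "card B > 0" and card_T_pos: "card T > 0"
  using finite_V finite_B finite_T V_ne B_ne T_ne by (auto simp: card_gt_0_iff)

lemma step_weight_pos: "step_weight > 0" unfolding step_weight_def using card_V_pos card_B_pos card_T_pos by simp

lemma T_mapsto: "\<tau> \<in> T \<Longrightarrow> i \<in> {1..n} \<Longrightarrow> \<tau> i \<in> {1..m}"
  unfolding to_one_maps_def by (auto simp: PiE_iff)

lemma T_fibres:
  assumes "\<tau> \<in> T"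
  shows "card {i \<in> {1..n}. Q (\<tau> i)} = s * card {j \<in> {1..m}. Q j}"
proof -
  have "{i \<in> {1..n}. Q (\<tau> i)} = (\<Union>j\<in>{j \<in> {1..m}. Q j}. {i \<in> {1..n}. \<tau> i = j})"
    using T_mapsto[OF assms] by auto
  also have "card \<dots> = (\<Sum>j\<in>{j \<in> {1..m}. Q j}. card {i \<in> {1..n}. \<tau> i = j})"
    by (intro card_UN_disjoint) auto
  also have "\<dots> = (\<Sum>j\<in>{j \<in> {1..m}. Q j}. s)"
    using assms unfolding to_one_maps_def by (intro sum.cong) auto
  finally show ?thesis by simp
qed

lemma pullback_apply: "i \<in> {1..n} \<Longrightarrow> pb \<tau> y i = y (\<tau> i)"
  unfolding pullback_word_def by auto

lemma pullback_in_V: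
  assumes "\<tau> \<in> T" "y \<in> B" shows "pb \<tau> y \<in> V"
proof -
  have "card {i \<in> {1..n}. pb \<tau> y i = c} = m" if "c \<in> S" for c
  proof -
    have "{i \<in> {1..n}. pb \<tau> y i = c} = {i \<in> {1..n}. y (\<tau> i) = c}"
      by (auto simp: pullback_apply)
    then show ?thesis
      using T_fibres[OF assms(1), of "\<lambda>j. y j = c"] assms(2) that unfolding balanced_words_def m_def by auto
  qed
  moreover have "pb \<tau> y \<in> {1..n} \<rightarrow>\<^sub>E S"
    using assms T_mapsto[OF assms(1)] unfolding pullback_word_def balanced_words_def by auto
  ultimately show ?thesis unfolding V_eq balanced_words_def by blast
qed

text \<open>For fixed \<tau> the double sum over a and b is the outer product of one vector with
  itself. This is the source of both the symmetry and the positive semidefiniteness of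
  \<open>W\<close>.\<close>

lemma walk_matrix_eq:
  "W u v = step_weight * (\<Sum>\<tau>\<in>T. \<Sum>a\<in>B. \<Sum>b\<in>B. if pb \<tau> a = u \<and> pb \<tau> b = v then 1 else 0)"
proof -
  have eq: "pair_pmf (pmf_of_set B) (pair_pmf (pmf_of_set B) (pmf_of_set T)) = pmf_of_set (B \<times> B \<times> T)"
    using finite_B finite_T B_ne T_ne by (simp add: pair_pmf_of_set)
  let ?f = "\<lambda>(a, b, \<tau>). (pb \<tau> a, pb \<tau> b)"
  have "walk_pair_pmf S k = map_pmf ?f (pmf_of_set (B \<times> B \<times> T))"
    unfolding walk_pair_pmf_def Let_def card_S n_def[symmetric] m_def[symmetric] eq ..
  then have "measure_pmf.prob (walk_pair_pmf S k) {(u, v)}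
      = measure_pmf.prob (pmf_of_set (B \<times> B \<times> T)) (?f -` {(u, v)})"
    by simp
  also have "\<dots> = card ((B \<times> B \<times> T) \<inter> ?f -` {(u, v)}) / card (B \<times> B \<times> T)"
    using finite_B finite_T B_ne T_ne by (intro measure_pmf_of_set) auto
  also have "real (card ((B \<times> B \<times> T) \<inter> ?f -` {(u, v)})) = (\<Sum>z\<in>B \<times> B \<times> T. if z \<in> ?f -` {(u, v)} then 1 else 0)"
    using finite_B finite_T by (simp add: sum.If_cases Int_def)
  also have "\<dots> = (\<Sum>a\<in>B. \<Sum>b\<in>B. \<Sum>\<tau>\<in>T. if pb \<tau> a = u \<and> pb \<tau> b = v then 1 else 0)"
    by (simp add: sum.cartesian_product case_prod_unfold split: if_splits)
  also have "\<dots> = (\<Sum>a\<in>B. \<Sum>\<tau>\<in>T. \<Sum>b\<in>B. if pb \<tau> a = u \<and> pb \<tau> b = v then 1 else 0)"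
    by (intro sum.cong refl sum.swap)
  also have "\<dots> = (\<Sum>\<tau>\<in>T. \<Sum>a\<in>B. \<Sum>b\<in>B. if pb \<tau> a = u \<and> pb \<tau> b = v then 1 else 0)"
    by (rule sum.swap)
  finally show ?thesis unfolding walk_matrix_def step_weight_def
    by (simp add: card_cartesian_product power2_eq_square)
qed

lemma W_sum_right:
  "(\<Sum>v\<in>V. W u v * g v) = step_weight * (\<Sum>\<tau>\<in>T. \<Sum>a\<in>B. if pb \<tau> a = u then (\<Sum>b\<in>B. g (pb \<tau> b)) else 0)"
proof -
  have "(\<Sum>v\<in>V. W u v * g v)
      = (\<Sum>v\<in>V. step_weight * (\<Sum>\<tau>\<in>T. \<Sum>a\<in>B. \<Sum>b\<in>B. if pb \<tau> a = u \<and> pb \<tau> b = v then g v else 0))"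
    unfolding walk_matrix_eq mult.assoc sum_distrib_right
    by (intro sum.cong refl arg_cong[of _ _ "(*) step_weight"]) simp
  also have "\<dots> = step_weight * (\<Sum>\<tau>\<in>T. \<Sum>a\<in>B. \<Sum>b\<in>B. \<Sum>v\<in>V. if pb \<tau> a = u \<and> pb \<tau> b = v then g v else 0)"
    unfolding sum_distrib_left[symmetric]
    by (subst sum_swap2) (intro arg_cong[of _ _ "(*) step_weight"] sum.cong refl sum.swap)
  also have "\<dots> = step_weight * (\<Sum>\<tau>\<in>T. \<Sum>a\<in>B. if pb \<tau> a = u then (\<Sum>b\<in>B. g (pb \<tau> b)) else 0)"
  proof -
    have "(\<Sum>b\<in>B. \<Sum>v\<in>V. if pb \<tau> a = u \<and> pb \<tau> b = v then g v else 0) =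
      (if pb \<tau> a = u then (\<Sum>b\<in>B. g (pb \<tau> b)) else 0)" if "\<tau> \<in> T" for \<tau> a
      using pullback_in_V[OF that] finite_V by (auto intro!: sum.cong)
    then show ?thesis by (simp cong: sum.cong)
  qed
  finally show ?thesis .
qed

lemma W_sum_both:
  "(\<Sum>u\<in>V. \<Sum>v\<in>V. W u v * F u v) = step_weight * (\<Sum>\<tau>\<in>T. \<Sum>a\<in>B. \<Sum>b\<in>B. F (pb \<tau> a) (pb \<tau> b))"
proof -
  have "(\<Sum>u\<in>V. \<Sum>v\<in>V. W u v * F u v)
      = step_weight * (\<Sum>u\<in>V. \<Sum>\<tau>\<in>T. \<Sum>a\<in>B. if pb \<tau> a = u then (\<Sum>b\<in>B. F u (pb \<tau> b)) else 0)"
    by (simp add: W_sum_right sum_distrib_left)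
  also have "\<dots> = step_weight * (\<Sum>\<tau>\<in>T. \<Sum>a\<in>B. \<Sum>u\<in>V. if pb \<tau> a = u then (\<Sum>b\<in>B. F u (pb \<tau> b)) else 0)"
    by (subst sum_swap2) (rule refl)
  also have "\<dots> = step_weight * (\<Sum>\<tau>\<in>T. \<Sum>a\<in>B. \<Sum>b\<in>B. F (pb \<tau> a) (pb \<tau> b))"
    using pullback_in_V finite_V by (intro arg_cong[of _ _ "(*) step_weight"] sum.cong[OF refl]) simp
  finally show ?thesis .
qed

lemma W_sym: "W u v = W v u"
proof -
  have "(\<Sum>a\<in>B. \<Sum>b\<in>B. if pb \<tau> a = u \<and> pb \<tau> b = v then 1 else 0 :: real)
     = (\<Sum>a\<in>B. \<Sum>b\<in>B. if pb \<tau> a = v \<and> pb \<tau> b = u then 1 else 0)" for \<tau>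
    by (subst sum.swap) (simp add: conj_commute)
  then show ?thesis unfolding walk_matrix_eq by simp
qed

lemma W_nonneg: "0 \<le> W u v"
  unfolding walk_matrix_eq using step_weight_pos by (intro mult_nonneg_nonneg sum_nonneg) auto

lemma comp_in_V: "u \<in> V \<Longrightarrow> p permutes {1..n} \<Longrightarrow> u \<circ> p \<in> V"
  unfolding V_eq by (rule balanced_words_comp_permutes)

lemma comp_in_T: "\<tau> \<in> T \<Longrightarrow> p permutes {1..n} \<Longrightarrow> \<tau> \<circ> p \<in> T"
  unfolding to_one_maps_eq_balanced_words by (rule balanced_words_comp_permutes)

lemma pullback_comp:
  assumes "p permutes {1..n}" shows "pb (\<tau> \<circ> p) y = pb \<tau> y \<circ> p"
  using assms unfolding pullback_word_def
  by (auto simp: fun_eq_iff restrict_def permutes_in_image permutes_not_in)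
    (metis atLeastAtMost_iff permutes_in_image)+

lemma comp_in_B: "y \<in> B \<Longrightarrow> p permutes {1..m} \<Longrightarrow> y \<circ> p \<in> B"
  by (rule balanced_words_comp_permutes)

lemmas bij_comp_B = bij_betw_comp_permutes[OF _ comp_in_B]
lemmas bij_comp_V = bij_betw_comp_permutes[OF _ comp_in_V]
lemmas bij_comp_T = bij_betw_comp_permutes[OF _ comp_in_T]

lemma comp_permutes_eq_iff: "p permutes X \<Longrightarrow> u \<circ> p = v \<circ> p \<longleftrightarrow> u = v"
  by (metis comp_id o_assoc permutes_inv_o(1))

text \<open>Replacing \<tau> by \<open>\<tau> \<circ> p\<close> permutes \<open>T\<close> and moves
  both pulled-back words by the same \<open>p\<close>.\<close>

lemma W_comp:
  assumes p: "p permutes {1..n}" shows "W (u \<circ> p) (v \<circ> p) = W u v"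
proof -
  have "(\<Sum>\<tau>\<in>T. \<Sum>a\<in>B. \<Sum>b\<in>B. if pb \<tau> a = u \<circ> p \<and> pb \<tau> b = v \<circ> p then 1 else 0 :: real)
    = (\<Sum>\<tau>\<in>T. \<Sum>a\<in>B. \<Sum>b\<in>B. if pb (\<tau> \<circ> p) a = u \<circ> p \<and> pb (\<tau> \<circ> p) b = v \<circ> p then 1 else 0)"
    by (rule sum.reindex_bij_betw[OF bij_comp_T[OF p], symmetric])
  then show ?thesis unfolding walk_matrix_eq by (simp add: pullback_comp[OF p] comp_permutes_eq_iff[OF p])
qed

lemma V_transitive:
  assumes "u \<in> V" "v \<in> V" obtains p where "p permutes {1..n}" "u = v \<circ> p"
  using balanced_words_transitive assms unfolding V_eq by metis

text \<open>Double counting: by transitivity every word has equally many preimages (\<tau>, a),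
  hence |T||B|/|V| of them.\<close>

lemma card_preimages:
  assumes "u \<in> V"
  shows "(\<Sum>\<tau>\<in>T. \<Sum>a\<in>B. if pb \<tau> a = u then 1 else 0 :: real) = 1 / (step_weight * card B)"
proof -
  let ?c = "\<lambda>u. (\<Sum>\<tau>\<in>T. \<Sum>a\<in>B. if pb \<tau> a = u then 1 else 0 :: real)"
  have const: "?c v = ?c u" if v: "v \<in> V" for v
  proof -
    obtain p where p: "p permutes {1..n}" "v = u \<circ> p" using V_transitive[OF v assms] .
    have "?c v = (\<Sum>\<tau>\<in>T. \<Sum>a\<in>B. if pb (\<tau> \<circ> p) a = v then 1 else 0)"
      by (rule sum.reindex_bij_betw[OF bij_comp_T[OF p(1)], symmetric])
    then show ?thesis by (simp add: pullback_comp[OF p(1)] p(2) comp_permutes_eq_iff[OF p(1)])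
  qed
  have "card V * ?c u = (\<Sum>v\<in>V. ?c v)" using const by simp
  also have "\<dots> = (\<Sum>\<tau>\<in>T. \<Sum>a\<in>B. \<Sum>v\<in>V. if pb \<tau> a = v then 1 else 0)"
    by (rule sum_swap2)
  also have "\<dots> = (\<Sum>\<tau>\<in>T. \<Sum>a\<in>B. 1)"
    using pullback_in_V finite_V by (intro sum.cong refl) auto
  finally show ?thesis using card_V_pos card_B_pos card_T_pos
    unfolding step_weight_def by (simp add: field_simps power2_eq_square)
qed

lemma W_row_sum: assumes "u \<in> V" shows "(\<Sum>v\<in>V. W u v) = 1"
proof -
  have "(\<Sum>v\<in>V. W u v) = step_weight * (\<Sum>\<tau>\<in>T. \<Sum>a\<in>B. if pb \<tau> a = u then real (card B) else 0)"
    using W_sum_right[of u "\<lambda>_. 1"] by (simp cong: if_cong)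
  also have "\<dots> = step_weight * (real (card B) * (\<Sum>\<tau>\<in>T. \<Sum>a\<in>B. if pb \<tau> a = u then 1 else 0 :: real))"
    by (simp add: sum_distrib_left if_distrib cong: if_cong)
  finally show ?thesis using card_preimages[OF assms] step_weight_pos card_B_pos by simp
qed

lemma symmetric_random_walk: "symmetric_random_walk_matrix V W"
  unfolding symmetric_random_walk_matrix_def using W_sym W_nonneg W_row_sum by blast

end

section \<open>Eigenfunctions with prescribed signs under disjoint transpositions\<close>

lemma transpose_comp_bij:
  assumes "inj \<sigma>"
  shows "Transposition.transpose (\<sigma> a) (\<sigma> b) \<circ> \<sigma> = \<sigma> \<circ> Transposition.transpose a b"
  using assms by (auto simp: fun_eq_iff Transposition.transpose_def inj_def)

context balanced_walk begin

definition eigenfunction :: "real \<Rightarrow> ((nat \<Rightarrow> 'a) \<Rightarrow> real) \<Rightarrow> bool" where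
  "eigenfunction \<mu> f \<longleftrightarrow> (\<exists>u\<in>V. f u \<noteq> 0) \<and> (\<forall>u\<in>V. (\<Sum>v\<in>V. W u v * f v) = \<mu> * f u) \<and> (\<Sum>u\<in>V. f u) = 0"

text \<open>The transpositions are fixed once and for all as those of the pairs (1,2), (3,4), and so
  on; sign -1 means antisymmetric and 1 symmetric. Other disjoint transpositions are brought to
  these places by permuting positions.\<close>

definition sign_pattern :: "nat \<Rightarrow> (nat \<Rightarrow> real) \<Rightarrow> ((nat \<Rightarrow> 'a) \<Rightarrow> real) \<Rightarrow> bool" where
  "sign_pattern l \<epsilon> f \<longleftrightarrow> (\<forall>i\<in>{1..l}. \<forall>u\<in>V. f (u \<circ> Transposition.transpose (2 * i - 1) (2 * i)) = \<epsilon> i * f u)"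

lemma eigenfunction_comp:
  assumes "eigenfunction \<mu> f" and p: "p permutes {1..n}"
  shows "eigenfunction \<mu> (\<lambda>u. f (u \<circ> p))"
proof -
  note bij = bij_comp_V[OF p]
  have "\<exists>u\<in>V. f (u \<circ> p) \<noteq> 0"
    using assms(1) bij unfolding eigenfunction_def bij_betw_def by (metis (no_types, lifting) imageE)
  moreover have "(\<Sum>u\<in>V. f (u \<circ> p)) = 0"
    using assms(1) sum.reindex_bij_betw[OF bij, of f] unfolding eigenfunction_def by simp
  moreover have "(\<Sum>v\<in>V. W u v * f (v \<circ> p)) = \<mu> * f (u \<circ> p)" if "u \<in> V" for u
  proof -
    have "(\<Sum>v\<in>V. W u v * f (v \<circ> p)) = (\<Sum>v\<in>V. W (u \<circ> p) (v \<circ> p) * f (v \<circ> p))"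
      by (simp add: W_comp[OF p])
    also have "\<dots> = (\<Sum>v\<in>V. W (u \<circ> p) v * f v)"
      by (rule sum.reindex_bij_betw[OF bij])
    finally show ?thesis using assms(1) comp_in_V[OF that p] unfolding eigenfunction_def by simp
  qed
  ultimately show ?thesis unfolding eigenfunction_def by blast
qed

lemma eigenfunction_add_scaled:
  assumes "eigenfunction \<mu> f" "eigenfunction \<mu> g" "\<exists>u\<in>V. f u + c * g u \<noteq> 0"
  shows "eigenfunction \<mu> (\<lambda>u. f u + c * g u)"
proof -
  have "(\<Sum>v\<in>V. W u v * (f v + c * g v)) = \<mu> * (f u + c * g u)" if "u \<in> V" for u
  proof -
    have "(\<Sum>v\<in>V. W u v * (f v + c * g v)) = (\<Sum>v\<in>V. W u v * f v) + c * (\<Sum>v\<in>V. W u v * g v)"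
      by (simp add: algebra_simps sum.distrib sum_distrib_left)
    then show ?thesis using assms that unfolding eigenfunction_def by (simp add: algebra_simps)
  qed
  moreover have "(\<Sum>u\<in>V. f u + c * g u) = 0"
    using assms unfolding eigenfunction_def by (simp add: sum.distrib sum_distrib_left[symmetric])
  ultimately show ?thesis using assms(3) unfolding eigenfunction_def by blast
qed

lemma transpose_permutes: "i \<in> {1..n} \<Longrightarrow> j \<in> {1..n} \<Longrightarrow> Transposition.transpose i j permutes {1..n}"
  by (rule permutes_swap_id)

text \<open>Adding to \<open>f\<close> its transposed copy with the right sign produces the new
  symmetry. The old ones survive since the new transposition is disjoint from the earlier pairs and
  commutes with theirs. A permutation then moves i and j to the next standard pair.\<close>

lemma sign_pattern_extend:
  assumes e: "eigenfunction \<mu> f" and pt: "sign_pattern l \<epsilon> f" and ij: "i \<in> {2 * l + 1..n}" "j \<in> {2 * l + 1..n}" "i \<noteq> j"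
    and sgn: "\<epsilon> (Suc l) * \<epsilon> (Suc l) = 1" and nz: "\<exists>u\<in>V. f u + \<epsilon> (Suc l) * f (u \<circ> Transposition.transpose i j) \<noteq> 0"
  shows "\<exists>f'. eigenfunction \<mu> f' \<and> sign_pattern (Suc l) \<epsilon> f'"
proof -
  let ?t = "Transposition.transpose i j" and ?c = "\<epsilon> (Suc l)"
  define g where "g u = f u + ?c * f (u \<circ> ?t)" for u
  have tp: "?t permutes {1..n}" using ij by (intro transpose_permutes) auto
  have eg: "eigenfunction \<mu> g" unfolding g_def using eigenfunction_add_scaled[OF e eigenfunction_comp[OF e tp]] nz by auto
  have gt: "g (u \<circ> ?t) = ?c * g u" for u
    using sgn by (simp add: g_def o_assoc[symmetric] algebra_simps)
  have gp: "g (u \<circ> Transposition.transpose (2 * r - 1) (2 * r)) = \<epsilon> r * g u"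
    if r: "r \<in> {1..l}" and u: "u \<in> V" for r u
  proof -
    let ?r = "Transposition.transpose (2 * r - 1) (2 * r)"
    have "?t (2 * r - 1) = 2 * r - 1" "?t (2 * r) = 2 * r"
      using r ij by (auto simp: Transposition.transpose_def)
    then have "?r \<circ> ?t = ?t \<circ> ?r"
      using transpose_comp_bij[of ?t "2 * r - 1" "2 * r"] by simp
    then have "f (u \<circ> ?r \<circ> ?t) = f (u \<circ> ?t \<circ> ?r)" by (simp add: o_assoc[symmetric])
    also have "\<dots> = \<epsilon> r * f (u \<circ> ?t)" using pt r comp_in_V[OF u tp] unfolding sign_pattern_def by blast
    finally show ?thesis using pt r u unfolding g_def sign_pattern_def by (simp add: algebra_simps)
  qed
  \<comment> \<open>\<sigma> must send i to 2l+1 and j to 2l+2 and fix everything up to 2l. The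
    second transposition acts on \<open>j1\<close> rather than j because the first one moves j in
    case j = 2l+1.\<close>
  define \<sigma>1 where "\<sigma>1 = Transposition.transpose i (2 * l + 1)"
  define j1 where "j1 = \<sigma>1 j"
  define \<sigma> where "\<sigma> = Transposition.transpose j1 (2 * l + 2) \<circ> \<sigma>1"
  have j1: "j1 \<noteq> 2 * l + 1" "j1 \<in> {2 * l + 1..n}" using ij unfolding j1_def \<sigma>1_def by (auto simp: Transposition.transpose_def)
  have n2: "2 * l + 2 \<le> n" using ij by auto
  have \<sigma>p: "\<sigma> permutes {1..n}" unfolding \<sigma>_def \<sigma>1_def
    using ij j1 n2 by (intro permutes_compose transpose_permutes) auto
  have inj: "inj \<sigma>" using permutes_inj[OF \<sigma>p] .
  have \<sigma>i: "\<sigma> i = 2 * l + 1" "\<sigma> j = 2 * l + 2"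
    using j1 unfolding \<sigma>_def j1_def[symmetric] by (auto simp: \<sigma>1_def j1_def[symmetric])
      (simp add: j1_def \<sigma>1_def)
  have \<sigma>fix: "\<sigma> r = r" if "r \<le> 2 * l" for r
    using that ij j1 unfolding \<sigma>_def \<sigma>1_def by (auto simp: Transposition.transpose_def)
  have "sign_pattern (Suc l) \<epsilon> (\<lambda>u. g (u \<circ> \<sigma>))"
    unfolding sign_pattern_def
  proof (intro ballI)
    fix r u assume r: "r \<in> {1..Suc l}" and u: "u \<in> V"
    let ?r = "Transposition.transpose (2 * r - 1) (2 * r)"
    show "g (u \<circ> ?r \<circ> \<sigma>) = \<epsilon> r * g (u \<circ> \<sigma>)"
    proof (cases "r = Suc l")
      case True
      have "?r \<circ> \<sigma> = \<sigma> \<circ> ?t"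
        using transpose_comp_bij[OF inj, of i j] \<sigma>i True by simp
      then have "g (u \<circ> ?r \<circ> \<sigma>) = g (u \<circ> \<sigma> \<circ> ?t)" by (simp add: o_assoc[symmetric])
      then show ?thesis using gt True by simp
    next
      case False
      then have r': "r \<in> {1..l}" using r by auto
      have "\<sigma> (2 * r - 1) = 2 * r - 1" "\<sigma> (2 * r) = 2 * r"
        using r' by (intro \<sigma>fix; auto)+
      then have "?r \<circ> \<sigma> = \<sigma> \<circ> ?r"
        using transpose_comp_bij[OF inj, of "2 * r - 1" "2 * r"] by simp
      then have "g (u \<circ> ?r \<circ> \<sigma>) = g (u \<circ> \<sigma> \<circ> ?r)" by (simp add: o_assoc[symmetric])
      then show ?thesis using gp[OF r' comp_in_V[OF u \<sigma>p]] by simp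
    qed
  qed
  then show ?thesis using eigenfunction_comp[OF eg \<sigma>p] by blast
qed

text \<open>Two words of \<open>V\<close> with a common prefix also have equal letter counts beyond
  it, so a permutation of the tail takes one to the other, and that permutation is a product of
  transpositions of tail positions.\<close>

lemma invariant_transpositions_agree:
  assumes inv: "\<And>i j u. i \<in> {l + 1..n} \<Longrightarrow> j \<in> {l + 1..n} \<Longrightarrow> u \<in> V \<Longrightarrow> f (u \<circ> Transposition.transpose i j) = f u"
    and uv: "u \<in> V" "v \<in> V" "\<forall>i\<in>{1..l}. u i = v i" and l: "l \<le> n"
  shows "f u = (f v :: real)"
proof -
  have "card {i \<in> {l+1..n}. u i = c} = card {i \<in> {l+1..n}. v i = c}" for c
  proof -
    have split: "card {i \<in> {1..n}. w i = c} = card {i \<in> {1..l}. w i = c} + card {i \<in> {l+1..n}. w i = c}"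
      for w :: "nat \<Rightarrow> 'a"
      using l by (subst card_Un_disjoint[symmetric]) (auto intro!: arg_cong[of _ _ card])
    have "card {i \<in> {1..n}. u i = c} = card {i \<in> {1..n}. v i = c}"
    proof -
      obtain p where p: "p permutes {1..n}" "u = v \<circ> p" using V_transitive[OF uv(1,2)] .
      then show ?thesis using card_fibres_comp_permutes[OF p(1), of "\<lambda>i. v i = c"] by simp
    qed
    moreover have "{i \<in> {1..l}. u i = c} = {i \<in> {1..l}. v i = c}" using uv(3) by auto
    ultimately show ?thesis using split[of u] split[of v] by simp
  qed
  then obtain p where p: "p permutes {l+1..n}" "\<forall>i\<in>{l+1..n}. u i = v (p i)"
    using equal_fibre_cards_permute[of "{l+1..n}" u v] by auto
  have pn: "q permutes {1..n}" if "q permutes {l+1..n}" for q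
    by (rule permutes_subset[OF that]) auto
  have "u = v \<circ> p"
  proof
    fix i
    consider "i \<in> {1..l}" | "i \<in> {l+1..n}" | "i \<notin> {1..n}" by force
    then show "u i = (v \<circ> p) i"
    proof cases
      case 1 then show ?thesis using uv(3) p(1) by (simp add: permutes_not_in)
    next
      case 2 then show ?thesis using p by simp
    next
      case 3
      then have "u i = undefined" "v i = undefined"
        using uv(1,2) unfolding V_eq balanced_words_def by (auto simp: PiE_iff extensional_def)
      then show ?thesis using permutes_not_in[OF pn[OF p(1)] 3] by simp
    qed
  qed
  moreover have "\<forall>v\<in>V. f (v \<circ> p) = f v"
    using p(1) finite_atLeastAtMost
  proof (induction rule: permutes_induct)
    case (swap a b q)
    have "f (v \<circ> (Transposition.transpose a b \<circ> q)) = f v" if "v \<in> V" for v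
    proof -
      have "v \<circ> Transposition.transpose a b \<in> V"
        using that swap by (intro comp_in_V transpose_permutes) auto
      then have "f (v \<circ> Transposition.transpose a b \<circ> q) = f (v \<circ> Transposition.transpose a b)"
        using swap by blast
      then show ?thesis using inv[OF swap(1,2) that] by (simp add: o_assoc)
    qed
    then show ?case by blast
  qed simp
  ultimately show ?thesis using uv by simp
qed

text \<open>Given that the pullback is u, positions with different letters never share a block. If
  the letters agree, the m - 1 other positions carrying the letter of i are equally likely to share
  its block, and exactly s - 1 of them do.\<close>

lemma same_block_count:
  assumes u: "u \<in> V" and ij: "i \<in> {1..n}" "j \<in> {1..n}" "i \<noteq> j"
  shows "(\<Sum>\<tau>\<in>T. \<Sum>a\<in>B. if pb \<tau> a = u \<and> \<tau> i = \<tau> j then 1 else 0 :: real) \<le>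
    (s - 1) / (m - 1) * (\<Sum>\<tau>\<in>T. \<Sum>a\<in>B. if pb \<tau> a = u then 1 else 0)"
proof (cases "u i = u j")
  case False
  have "(if pb \<tau> a = u \<and> \<tau> i = \<tau> j then 1 else 0 :: real) = 0" for \<tau> a
    using False ij pullback_apply by (metis (no_types, lifting))
  then have "(\<Sum>\<tau>\<in>T. \<Sum>a\<in>B. if pb \<tau> a = u \<and> \<tau> i = \<tau> j then 1 else 0 :: real) = 0" by simp
  then show ?thesis
    using s_ge m_pos by (simp del: of_nat_diff) (intro divide_nonneg_nonneg mult_nonneg_nonneg sum_nonneg; simp)
next
  case True
  define F where "F j = (\<Sum>\<tau>\<in>T. \<Sum>a\<in>B. if pb \<tau> a = u \<and> \<tau> i = \<tau> j then 1 else 0 :: real)" for j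
  define X where "X = {j \<in> {1..n}. u j = u i} - {i}"
  have "u i \<in> S" using u ij unfolding V_eq balanced_words_def by auto
  then have cX: "card X = m - 1"
    using u ij unfolding X_def V_eq balanced_words_def by (subst card_Diff_singleton) auto
  have jX: "j \<in> X" using ij True unfolding X_def by auto
  have const: "F j' = F j" if "j' \<in> X" for j'
  proof -
    let ?t = "Transposition.transpose j j'"
    have p: "?t permutes {1..n}" using that ij unfolding X_def by (intro transpose_permutes) auto
    have ut: "u \<circ> ?t = u" using that jX unfolding X_def by (auto simp: fun_eq_iff Transposition.transpose_def)
    have ti: "?t i = i" "?t j' = j" using that jX unfolding X_def by auto
    have "F j' = (\<Sum>\<tau>\<in>T. \<Sum>a\<in>B. if pb (\<tau> \<circ> ?t) a = u \<and> (\<tau> \<circ> ?t) i = (\<tau> \<circ> ?t) j' then 1 else 0)"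
      unfolding F_def by (rule sum.reindex_bij_betw[OF bij_comp_T[OF p], symmetric])
    also have "\<dots> = F j"
      unfolding F_def pullback_comp[OF p] using ti comp_permutes_eq_iff[OF p, of _ u] ut
      by (simp add: o_def[symmetric])
    finally show ?thesis .
  qed
  have "(m - 1) * F j = (\<Sum>j'\<in>X. F j')" using const cX by simp
  also have "\<dots> = (\<Sum>\<tau>\<in>T. \<Sum>a\<in>B. \<Sum>j'\<in>X. if pb \<tau> a = u \<and> \<tau> i = \<tau> j' then 1 else 0)"
    unfolding F_def by (rule sum_swap2)
  also have "\<dots> = (\<Sum>\<tau>\<in>T. \<Sum>a\<in>B. if pb \<tau> a = u then real (s - 1) else 0)"
  proof (intro sum.cong refl)
    fix \<tau> a assume \<tau>: "\<tau> \<in> T"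
    show "(\<Sum>j'\<in>X. if pb \<tau> a = u \<and> \<tau> i = \<tau> j' then 1 else 0) = (if pb \<tau> a = u then real (s - 1) else 0)"
    proof (cases "pb \<tau> a = u")
      case True
      then have "u j' = u i" if "j' \<in> {1..n}" "\<tau> j' = \<tau> i" for j'
        using that ij pullback_apply by metis
      then have "{j' \<in> X. \<tau> i = \<tau> j'} = {j' \<in> {1..n}. \<tau> j' = \<tau> i} - {i}" unfolding X_def by auto
      moreover have "card {j' \<in> {1..n}. \<tau> j' = \<tau> i} = s"
        using \<tau> T_mapsto[OF \<tau> ij(1)] unfolding to_one_maps_def by blast
      ultimately have "card {j' \<in> X. \<tau> i = \<tau> j'} = s - 1" using ij by (simp add: card_Diff_singleton)
      then show ?thesis using True by (simp add: sum.If_cases X_def Int_def)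
    qed simp
  qed
  also have "\<dots> = real (s - 1) * (\<Sum>\<tau>\<in>T. \<Sum>a\<in>B. if pb \<tau> a = u then 1 else 0)"
    by (simp add: sum_distrib_left if_distrib cong: if_cong)
  finally have *: "real (m - 1) * F j = real (s - 1) * (\<Sum>\<tau>\<in>T. \<Sum>a\<in>B. if pb \<tau> a = u then 1 else 0)" .
  have "m \<ge> 2" using s_ge k_ge unfolding m_def by (metis mult_le_mono nat_mult_1_right)
  then have "real (m - 1) > 0" by simp
  then have "F j = (s - 1) / (m - 1) * (\<Sum>\<tau>\<in>T. \<Sum>a\<in>B. if pb \<tau> a = u then 1 else 0)"
    using * by (simp add: field_simps)
  then show ?thesis unfolding F_def by simp
qed

end

section \<open>A spectral gap for every $k \ge 2$\<close>

lemma transpositions_steps: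
  fixes f :: "('i \<Rightarrow> 'b) \<Rightarrow> real" and \<eta> :: real
  assumes X: "\<And>u q. u \<in> X \<Longrightarrow> q permutes A \<Longrightarrow> u \<circ> q \<in> X"
    and step: "\<And>u i j. u \<in> X \<Longrightarrow> i \<in> A \<Longrightarrow> j \<in> A \<Longrightarrow> \<bar>f (u \<circ> Transposition.transpose i j) - f u\<bar> \<le> \<eta>"
    and "\<forall>(a, b)\<in>set xs. a \<noteq> b \<and> a \<in> A \<and> b \<in> A" "u \<in> X"
  shows "\<bar>f (u \<circ> apply_transps xs) - f u\<bar> \<le> length xs * \<eta>"
  using assms(3,4)
proof (induction xs arbitrary: u)
  case (Cons ab xs)
  obtain a b where ab: "ab = (a, b)" by (cases ab)
  let ?v = "u \<circ> Transposition.transpose a b"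
  have "?v \<in> X" using Cons.prems ab by (intro X permutes_swap_id) auto
  then have "\<bar>f (?v \<circ> apply_transps xs) - f ?v\<bar> \<le> length xs * \<eta>" by (rule Cons.IH[rotated]) (use Cons.prems in auto)
  moreover have "\<bar>f ?v - f u\<bar> \<le> \<eta>" using Cons.prems ab by (intro step) auto
  moreover have "f (u \<circ> apply_transps (ab # xs)) = f (?v \<circ> apply_transps xs)"
    by (rule arg_cong[of _ _ f]) (auto simp: ab fun_eq_iff)
  moreover have "length (ab # xs) * \<eta> = length xs * \<eta> + \<eta>" by (simp add: algebra_simps)
  ultimately show ?case by linarith
qed simp

text \<open>The constant \<open>C\<close> does not depend on \<open>X\<close>, hence not on the alphabet; this is what makes the
  spectral gap uniform in \<open>S\<close>.\<close>
lemma permutes_steps_uniform: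
  assumes "finite (A :: 'i set)"
  obtains C :: nat where "\<And>p (X :: ('i \<Rightarrow> 'b) set) (f :: _ \<Rightarrow> real) (\<eta>::real) u. p permutes A \<Longrightarrow> 0 \<le> \<eta> \<Longrightarrow>
    (\<And>u q. u \<in> X \<Longrightarrow> q permutes A \<Longrightarrow> u \<circ> q \<in> X) \<Longrightarrow>
    (\<And>u i j. u \<in> X \<Longrightarrow> i \<in> A \<Longrightarrow> j \<in> A \<Longrightarrow> \<bar>f (u \<circ> Transposition.transpose i j) - f u\<bar> \<le> \<eta>) \<Longrightarrow>
    u \<in> X \<Longrightarrow> \<bar>f (u \<circ> p) - f u\<bar> \<le> C * \<eta>"
proof -
  have "\<forall>p\<in>{p. p permutes A}. \<exists>xs. (\<forall>(a, b)\<in>set xs. a \<noteq> b \<and> a \<in> A \<and> b \<in> A) \<and> apply_transps xs = p"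
    using permutes_from_transpositions[OF _ assms] by blast
  from bchoice[OF this] obtain xs where
    xs: "\<And>p. p permutes A \<Longrightarrow> (\<forall>(a, b)\<in>set (xs p). a \<noteq> b \<and> a \<in> A \<and> b \<in> A) \<and> apply_transps (xs p) = p"
    by auto
  show thesis
  \<comment> \<open>Adding up the lengths of chosen factorizations of all permutations bounds each
    of them at once.\<close>
  proof (rule that[of "\<Sum>p | p permutes A. length (xs p)"])
    fix p and X :: "('i \<Rightarrow> 'b) set" and f :: "_ \<Rightarrow> real" and \<eta> u
    assume p: "p permutes A" and \<eta>: "0 \<le> \<eta>" and X: "\<And>u q. u \<in> X \<Longrightarrow> q permutes A \<Longrightarrow> u \<circ> q \<in> X"
      and step: "\<And>u i j. u \<in> X \<Longrightarrow> i \<in> A \<Longrightarrow> j \<in> A \<Longrightarrow> \<bar>f (u \<circ> Transposition.transpose i j) - f u\<bar> \<le> \<eta>"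
      and u: "u \<in> X"
    have "\<bar>f (u \<circ> apply_transps (xs p)) - f u\<bar> \<le> length (xs p) * \<eta>"
      using xs[OF p] by (intro transpositions_steps[OF X step _ u]) auto
    moreover have "length (xs p) \<le> (\<Sum>p | p permutes A. length (xs p))"
      using p finite_permutations[OF assms] by (intro member_le_sum) auto
    then have "length (xs p) * \<eta> \<le> real (\<Sum>p | p permutes A. length (xs p)) * \<eta>"
      using \<eta> by (intro mult_right_mono) (simp_all only: of_nat_le_iff)
    ultimately show "\<bar>f (u \<circ> p) - f u\<bar> \<le> real (\<Sum>p | p permutes A. length (xs p)) * \<eta>"
      using xs[OF p] by simp
  qed
qed

context balanced_walk begin

lemma norm_pos: "eigenfunction \<mu> f \<Longrightarrow> (\<Sum>u\<in>V. (f u)\<^sup>2) > 0"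
  unfolding eigenfunction_def using finite_V by (auto intro!: sum_pos2)

lemma eigenfunction_quadratic: assumes "eigenfunction \<mu> f" shows "(\<Sum>u\<in>V. \<Sum>v\<in>V. W u v * (f u * f v)) = \<mu> * (\<Sum>u\<in>V. (f u)\<^sup>2)"
proof -
  have "(\<Sum>u\<in>V. \<Sum>v\<in>V. W u v * (f u * f v)) = (\<Sum>u\<in>V. f u * (\<Sum>v\<in>V. W u v * f v))"
    by (simp add: sum_distrib_left mult_ac)
  also have "\<dots> = (\<Sum>u\<in>V. f u * (\<mu> * f u))" using assms unfolding eigenfunction_def by (intro sum.cong) auto
  finally show ?thesis by (simp add: sum_distrib_left power2_eq_square mult_ac)
qed

text \<open>For each \<tau> the quadratic form is a square, so \<open>W\<close> is positive
  semidefinite and both ends of the spectrum are controlled by upper bounds on \<mu>.\<close>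

lemma eigenfunction_nonneg: assumes "eigenfunction \<mu> f" shows "\<mu> \<ge> 0"
proof -
  have "\<mu> * (\<Sum>u\<in>V. (f u)\<^sup>2) = step_weight * (\<Sum>\<tau>\<in>T. (\<Sum>a\<in>B. f (pb \<tau> a))\<^sup>2)"
    unfolding eigenfunction_quadratic[OF assms, symmetric] W_sum_both
    by (simp add: power2_eq_square sum_product)
  also have "\<dots> \<ge> 0" using step_weight_pos by (intro mult_nonneg_nonneg sum_nonneg) auto
  finally show ?thesis using norm_pos[OF assms] by (simp add: zero_le_mult_iff)
qed

text \<open>The Dirichlet form of an eigenfunction equals 2(1 - \<mu>) times its squared norm and is
  a sum of non-negative terms over triples (\<tau>, a, b); a single term is kept.\<close>

lemma dirichlet_term:
  assumes e: "eigenfunction \<mu> f" and "\<tau> \<in> T" "a \<in> B" "b \<in> B"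
  shows "step_weight * (f (pb \<tau> a) - f (pb \<tau> b))\<^sup>2 \<le> 2 * (1 - \<mu>) * (\<Sum>u\<in>V. (f u)\<^sup>2)"
proof -
  have "(\<Sum>u\<in>V. \<Sum>v\<in>V. W u v * (f u - f v)\<^sup>2) =
    (\<Sum>u\<in>V. \<Sum>v\<in>V. W u v * (f u)\<^sup>2) + (\<Sum>u\<in>V. \<Sum>v\<in>V. W u v * (f v)\<^sup>2) - 2 * (\<Sum>u\<in>V. \<Sum>v\<in>V. W u v * (f u * f v))"
    by (simp add: sum.distrib[symmetric] sum_subtractf[symmetric] sum_distrib_left power2_eq_square algebra_simps)
  also have "(\<Sum>u\<in>V. \<Sum>v\<in>V. W u v * (f u)\<^sup>2) = (\<Sum>u\<in>V. (f u)\<^sup>2)"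
    by (simp add: sum_distrib_right[symmetric] W_row_sum)
  also have "(\<Sum>u\<in>V. \<Sum>v\<in>V. W u v * (f v)\<^sup>2) = (\<Sum>v\<in>V. \<Sum>u\<in>V. W v u * (f v)\<^sup>2)"
    by (subst sum.swap) (simp add: W_sym)
  also have "\<dots> = (\<Sum>u\<in>V. (f u)\<^sup>2)"
    by (simp add: sum_distrib_right[symmetric] W_row_sum)
  finally have D: "(\<Sum>u\<in>V. \<Sum>v\<in>V. W u v * (f u - f v)\<^sup>2) = 2 * (1 - \<mu>) * (\<Sum>u\<in>V. (f u)\<^sup>2)"
    using eigenfunction_quadratic[OF e] by (simp add: algebra_simps)
  have "(f (pb \<tau> a) - f (pb \<tau> b))\<^sup>2 \<le> (\<Sum>b\<in>B. (f (pb \<tau> a) - f (pb \<tau> b))\<^sup>2)"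
    using assms finite_B by (intro member_le_sum) auto
  also have "\<dots> \<le> (\<Sum>a\<in>B. \<Sum>b\<in>B. (f (pb \<tau> a) - f (pb \<tau> b))\<^sup>2)"
    using assms finite_B by (intro member_le_sum[of a B "\<lambda>a. \<Sum>b\<in>B. (f (pb \<tau> a) - f (pb \<tau> b))\<^sup>2"] sum_nonneg) auto
  also have "\<dots> \<le> (\<Sum>\<tau>\<in>T. \<Sum>a\<in>B. \<Sum>b\<in>B. (f (pb \<tau> a) - f (pb \<tau> b))\<^sup>2)"
    using assms finite_T by (intro member_le_sum[of \<tau> T "\<lambda>\<tau>. \<Sum>a\<in>B. \<Sum>b\<in>B. (f (pb \<tau> a) - f (pb \<tau> b))\<^sup>2"] sum_nonneg) auto
  finally have "step_weight * (f (pb \<tau> a) - f (pb \<tau> b))\<^sup>2 \<le> step_weight * (\<Sum>\<tau>\<in>T. \<Sum>a\<in>B. \<Sum>b\<in>B. (f (pb \<tau> a) - f (pb \<tau> b))\<^sup>2)"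
    using step_weight_pos by (intro mult_left_mono) auto
  also have "\<dots> = (\<Sum>u\<in>V. \<Sum>v\<in>V. W u v * (f u - f v)\<^sup>2)" by (rule W_sum_both[symmetric])
  finally show ?thesis unfolding D .
qed

lemma preimage_exists: assumes "u \<in> V" obtains \<tau> a where "\<tau> \<in> T" "a \<in> B" "pb \<tau> a = u"
proof -
  have "(\<Sum>\<tau>\<in>T. \<Sum>a\<in>B. if pb \<tau> a = u then 1 else 0 :: real) \<noteq> 0"
    using card_preimages[OF assms] step_weight_pos card_B_pos by simp
  then obtain \<tau> where "\<tau> \<in> T" "(\<Sum>a\<in>B. if pb \<tau> a = u then 1 else 0 :: real) \<noteq> 0" by (rule sum.not_neutral_contains_not_neutral)
  moreover from this(2) obtain a where "a \<in> B" "(if pb \<tau> a = u then 1 else 0 :: real) \<noteq> 0" by (rule sum.not_neutral_contains_not_neutral)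
  ultimately show thesis using that by (metis (full_types))
qed

text \<open>This is where k \<ge> 2 enters: the letter at p occurs at a second position r, and
  exchanging q with r brings it to q.\<close>

lemma word_with_equal_letters:
  assumes "k \<ge> 2" "p \<in> {1..m}" "q \<in> {1..m}" "p \<noteq> q"
  obtains b where "b \<in> B" "b p = b q"
proof -
  obtain b where b: "b \<in> B" using B_ne by blast
  have "b p \<in> S" using b assms unfolding balanced_words_def by auto
  then have "card {i \<in> {1..m}. b i = b p} = k" using b unfolding balanced_words_def by blast
  then have "card ({i \<in> {1..m}. b i = b p} - {p}) \<ge> 1" using assms by (simp add: card_Diff_singleton)
  then have "{i \<in> {1..m}. b i = b p} - {p} \<noteq> {}" by (metis card.empty not_one_le_zero)
  then obtain r where r: "r \<in> {1..m}" "b r = b p" "r \<noteq> p" by auto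
  let ?t = "Transposition.transpose q r"
  have "b \<circ> ?t \<in> B" using comp_in_B[OF b permutes_swap_id[OF assms(3) r(1)]] .
  moreover have "(b \<circ> ?t) p = (b \<circ> ?t) q" using assms r by simp
  ultimately show thesis using that by blast
qed

text \<open>Both u and its transposed copy are one step away from a common word: pull back a word b
  with equal letters at \<open>\<tau> i\<close> and \<open>\<tau> j\<close>, so that the
  transposition fixes the result. The two steps account for the factor 2.\<close>

lemma swap_step:
  assumes e: "eigenfunction \<mu> f" and k: "k \<ge> 2" and u: "u \<in> V" and ij: "i \<in> {1..n}" "j \<in> {1..n}"
  shows "\<bar>f (u \<circ> Transposition.transpose i j) - f u\<bar> \<le> 2 * sqrt (2 * (1 - \<mu>) * (\<Sum>u\<in>V. (f u)\<^sup>2) / step_weight)"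
    (is "_ \<le> 2 * ?\<eta>")
proof -
  have step: "\<bar>f (pb \<tau> a) - f (pb \<tau> b)\<bar> \<le> ?\<eta>" if "\<tau> \<in> T" "a \<in> B" "b \<in> B" for \<tau> a b
    using dirichlet_term[OF e that] step_weight_pos by (intro real_le_rsqrt) (simp add: field_simps)
  have \<eta>0: "?\<eta> \<ge> 0" using step[of _ _ ] T_ne B_ne by (metis abs_ge_zero equals0I order_trans)
  let ?t = "Transposition.transpose i j"
  have t: "?t permutes {1..n}" by (rule transpose_permutes[OF ij])
  show ?thesis
  proof (cases "u i = u j")
    case True
    then have "u \<circ> ?t = u" by (auto simp: fun_eq_iff Transposition.transpose_def)
    then show ?thesis using \<eta>0 by simp
  next
    case False
    obtain \<tau> a where \<tau>: "\<tau> \<in> T" "a \<in> B" "pb \<tau> a = u" by (rule preimage_exists[OF u])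
    have "\<tau> i \<noteq> \<tau> j" using False \<tau>(3) ij pullback_apply by metis
    then obtain b where b: "b \<in> B" "b (\<tau> i) = b (\<tau> j)"
      using word_with_equal_letters[OF k T_mapsto[OF \<tau>(1) ij(1)] T_mapsto[OF \<tau>(1) ij(2)]] by metis
    have "pb \<tau> b i = pb \<tau> b j" using b ij by (simp add: pullback_apply)
    then have "pb (\<tau> \<circ> ?t) b = pb \<tau> b"
      unfolding pullback_comp[OF t] by (auto simp: fun_eq_iff Transposition.transpose_def)
    moreover have "pb (\<tau> \<circ> ?t) a = u \<circ> ?t" unfolding pullback_comp[OF t] \<tau>(3) ..
    ultimately have "\<bar>f (u \<circ> ?t) - f (pb \<tau> b)\<bar> \<le> ?\<eta>" using step[OF comp_in_T[OF \<tau>(1) t] \<tau>(2) b(1)] by simp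
    moreover have "\<bar>f u - f (pb \<tau> b)\<bar> \<le> ?\<eta>" using step[OF \<tau>(1,2) b(1)] \<tau>(3) by simp
    ultimately show ?thesis by linarith
  qed
qed

text \<open>Transpositions connect all of \<open>V\<close>, so the oscillation of f is at most C
  times the bound for one swap, and a function of mean zero is bounded by its oscillation. Squaring
  and summing makes the norm of f cancel; the factor \<open>card V\<close> cancels against
  \<open>step_weight\<close>. The crude bounds |B| \<le> s^m and |T| \<le> m^n leave a gap that
  depends on S only through s.\<close>

lemma spectral_gap:
  assumes e: "eigenfunction \<mu> f" and k: "k \<ge> 2" and C0: "C > (0::real)"
    and C: "\<And>p (f :: (nat \<Rightarrow> 'a) \<Rightarrow> real) \<eta> u. p permutes {1..n} \<Longrightarrow> 0 \<le> \<eta> \<Longrightarrow>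
    (\<And>u i j. u \<in> V \<Longrightarrow> i \<in> {1..n} \<Longrightarrow> j \<in> {1..n} \<Longrightarrow> \<bar>f (u \<circ> Transposition.transpose i j) - f u\<bar> \<le> \<eta>) \<Longrightarrow>
    u \<in> V \<Longrightarrow> \<bar>f (u \<circ> p) - f u\<bar> \<le> C * \<eta>"
  shows "\<mu> \<le> 1 - 1 / (8 * C\<^sup>2 * real s ^ (2 * m) * real m ^ n)"
proof -
  let ?Q = "\<Sum>u\<in>V. (f u)\<^sup>2"
  let ?\<eta> = "sqrt (2 * (1 - \<mu>) * ?Q / step_weight)"
  obtain u\<^sub>0 where "u\<^sub>0 \<in> V" using V_ne by blast
  have "1 \<in> {1..n}" using n_pos by simp
  have "0 \<le> 2 * ?\<eta>"
    by (rule order_trans[OF abs_ge_zero swap_step[OF e k \<open>u\<^sub>0 \<in> V\<close> \<open>1 \<in> {1..n}\<close> \<open>1 \<in> {1..n}\<close>]])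
  have diff: "\<bar>f u - f v\<bar> \<le> C * (2 * ?\<eta>)" if uv: "u \<in> V" "v \<in> V" for u v
  proof -
    obtain p where p: "p permutes {1..n}" "u = v \<circ> p" using V_transitive[OF uv] .
    have "\<bar>f (v \<circ> p) - f v\<bar> \<le> C * (2 * ?\<eta>)"
      by (rule C[OF p(1) \<open>0 \<le> 2 * ?\<eta>\<close> swap_step[OF e k] uv(2)])
    then show ?thesis using p(2) by simp
  qed
  have fu: "\<bar>f u\<bar> \<le> C * (2 * ?\<eta>)" if u: "u \<in> V" for u
  proof -
    have "card V * f u = (\<Sum>v\<in>V. f u - f v)" using e unfolding eigenfunction_def by (simp add: sum_subtractf)
    then have "card V * \<bar>f u\<bar> = \<bar>\<Sum>v\<in>V. f u - f v\<bar>" by (metis abs_mult abs_of_nat)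
    also have "\<dots> \<le> (\<Sum>v\<in>V. \<bar>f u - f v\<bar>)" by (rule sum_abs)
    also have "\<dots> \<le> card V * (C * (2 * ?\<eta>))" using diff[OF u] by (intro sum_bounded_above) auto
    finally show ?thesis using card_V_pos by simp
  qed
  have ar: "2 * (1 - \<mu>) * ?Q / step_weight \<ge> 0"
    using \<open>0 \<le> 2 * ?\<eta>\<close> by simp
  have "?Q \<le> card V * (C * (2 * ?\<eta>))\<^sup>2"
    using fu by (intro sum_bounded_above) (metis abs_ge_zero power2_abs power_mono)
  also have "\<dots> = card V * (8 * C\<^sup>2 * (1 - \<mu>) * ?Q / step_weight)"
    using ar by (simp add: power_mult_distrib)
  finally have "?Q * step_weight \<le> ?Q * (card V * (8 * C\<^sup>2 * (1 - \<mu>)))" using step_weight_pos by (simp add: field_simps)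
  then have "step_weight \<le> card V * (8 * C\<^sup>2 * (1 - \<mu>))" using norm_pos[OF e] by (simp only: mult_le_cancel_left_pos)
  then have *: "1 / (real (card B) ^ 2 * real (card T)) \<le> 8 * C\<^sup>2 * (1 - \<mu>)"
  proof -
    have "real (card V) * (1 / (real (card B) ^ 2 * real (card T))) \<le> card V * (8 * C\<^sup>2 * (1 - \<mu>))"
      using \<open>step_weight \<le> _\<close> unfolding step_weight_def by simp
    then show ?thesis using card_V_pos by (simp only: mult_le_cancel_left_pos of_nat_0_less_iff)
  qed
  have cB: "card B \<le> s ^ m"
  proof -
    have "card B \<le> card ({1..m} \<rightarrow>\<^sub>E S)"
      using finite_S unfolding balanced_words_def by (intro card_mono finite_PiE) auto
    then show ?thesis by (simp add: card_PiE card_S)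
  qed
  have cT: "card T \<le> m ^ n"
  proof -
    have "card T \<le> card ({1..n} \<rightarrow>\<^sub>E {1..m})"
      unfolding to_one_maps_def by (intro card_mono finite_PiE) auto
    then show ?thesis by (simp add: card_PiE)
  qed
  have "real (card B) ^ 2 * real (card T) \<le> (real s ^ m) ^ 2 * real m ^ n"
    using cB cT by (intro mult_mono power_mono) (simp_all flip: of_nat_power)
  then have "1 / ((real s ^ m) ^ 2 * real m ^ n) \<le> 1 / (real (card B) ^ 2 * real (card T))"
    using card_B_pos card_T_pos s_ge m_pos by (intro divide_left_mono mult_pos_pos zero_less_power) auto
  with * have **: "1 / ((real s ^ m) ^ 2 * real m ^ n) \<le> 8 * C\<^sup>2 * (1 - \<mu>)" by linarith
  then have "1 / ((real s ^ m) ^ 2 * real m ^ n) / (8 * C\<^sup>2) \<le> 1 - \<mu>"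
  proof -
    have "0 < 8 * C\<^sup>2" using C0 by simp
    then show ?thesis using ** unfolding pos_divide_le_eq[OF \<open>0 < 8 * C\<^sup>2\<close>]
      by (simp only: mult.commute)
  qed
  then show ?thesis by (simp add: power_mult[symmetric] mult_ac)
qed

end

section \<open>Eigenfunctions of low degree\<close>

context balanced_walk begin

lemma low_degree_bound:
  assumes e: "eigenfunction \<mu> f" and pt: "sign_pattern w (\<lambda>_. -1) f"
    and mx: "\<not> (\<exists>f'. eigenfunction \<mu> f' \<and> sign_pattern (Suc w) (\<lambda>_. -1) f')" and w: "2 * w \<le> n"
  shows "\<bar>\<mu>\<bar> \<le> (2 * real w)\<^sup>2 * (real (s - 1) / real (m - 1))"
proof -
  \<comment> \<open>If f changed under such a transposition, antisymmetrizing it would give an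
    eigenfunction for w + 1 pairs, contrary to \<open>mx\<close>.\<close>
  have inv: "f (u \<circ> Transposition.transpose i j) = f u"
    if "i \<in> {2 * w + 1..n}" "j \<in> {2 * w + 1..n}" "u \<in> V" for i j u
  proof (cases "i = j")
    case False
    show ?thesis
    proof (rule ccontr)
      assume "f (u \<circ> Transposition.transpose i j) \<noteq> f u"
      then have "\<exists>u\<in>V. f u + (-1) * f (u \<circ> Transposition.transpose i j) \<noteq> 0" using that(3) by (intro bexI[of _ u]) auto
      then show False using sign_pattern_extend[OF e pt that(1,2) False] mx by auto
    qed
  qed simp
  have dep: "f u = f v" if "u \<in> V" "v \<in> V" "\<forall>i\<in>{1..2 * w}. u i = v i" for u v
    using invariant_transpositions_agree[OF inv that w] by blast
  \<comment> \<open>With no antisymmetric pair f would be constant, hence zero because its sum is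
    zero.\<close>
  have w0: "w > 0"
  proof (rule ccontr)
    assume "\<not> w > 0"
    obtain u where u: "u \<in> V" "f u \<noteq> 0" using e unfolding eigenfunction_def by blast
    have "(\<Sum>v\<in>V. f v) = (\<Sum>v\<in>V. f u)" 
      by (intro sum.cong refl dep u(1)) (use \<open>\<not> w > 0\<close> in auto)
    then show False using e u card_V_pos unfolding eigenfunction_def by simp
  qed
  obtain u where u: "u \<in> V" and umax: "\<And>v. v \<in> V \<Longrightarrow> \<bar>f v\<bar> \<le> \<bar>f u\<bar>"
  proof -
    have "Max ((\<lambda>v. \<bar>f v\<bar>) ` V) \<in> (\<lambda>v. \<bar>f v\<bar>) ` V" using finite_V V_ne by (intro Max_in) auto
    then obtain u where "u \<in> V" "Max ((\<lambda>v. \<bar>f v\<bar>) ` V) = \<bar>f u\<bar>" by blast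
    then show thesis using that Max_ge[of "(\<lambda>v. \<bar>f v\<bar>) ` V"] finite_V by (metis finite_imageI imageI)
  qed
  have fu: "\<bar>f u\<bar> > 0" using e umax unfolding eigenfunction_def by (metis abs_ge_zero abs_zero linorder_not_less order_le_less zero_less_abs_iff)
  \<comment> \<open>Exchanging the letters of b in the blocks of positions 1 and 2 permutes
    \<open>B\<close>. As \<tau> is injective on the first 2w positions, f sees only an exchange of
    positions 1 and 2, which flips its sign, so the sum equals its own negative.\<close>
  have zero: "(\<Sum>b\<in>B. f (pb \<tau> b)) = 0" if \<tau>: "\<tau> \<in> T" and inj: "inj_on \<tau> {1..2 * w}" for \<tau>
  proof -
    have 12: "1 \<in> {1..n}" "2 \<in> {1..n}" "(1::nat) \<in> {1..2 * w}" "2 \<in> {1..2 * w}" using w w0 by auto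
    let ?t = "Transposition.transpose (\<tau> 1) (\<tau> 2)" and ?r = "Transposition.transpose (1::nat) 2"
    have t: "?t permutes {1..m}" using T_mapsto[OF \<tau>] 12 by (intro permutes_swap_id) auto
    have r: "?r permutes {1..n}" using 12 by (intro transpose_permutes)
    have "f (pb \<tau> (b \<circ> ?t)) = - f (pb \<tau> b)" if b: "b \<in> B" for b
    proof -
      have "f (pb \<tau> (b \<circ> ?t)) = f (pb \<tau> b \<circ> ?r)"
      proof (rule dep[OF pullback_in_V[OF \<tau> comp_in_B[OF b t]] comp_in_V[OF pullback_in_V[OF \<tau> b] r]], intro ballI)
        fix i assume i: "i \<in> {1..2 * w}"
        then have in': "i \<in> {1..n}" using w by auto
        have "?t (\<tau> i) = \<tau> (?r i)"
        proof (cases "i = 1 \<or> i = 2")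
          case False
          then have "\<tau> i \<noteq> \<tau> 1" "\<tau> i \<noteq> \<tau> 2" using inj_onD[OF inj _ i 12(3)] inj_onD[OF inj _ i 12(4)] by blast+
          then show ?thesis using False by simp
        qed auto
        then show "pb \<tau> (b \<circ> ?t) i = (pb \<tau> b \<circ> ?r) i"
          using in' r by (simp add: pullback_apply permutes_in_image del: atLeastAtMost_iff)
      qed
      also have "\<dots> = -1 * f (pb \<tau> b)"
        using pt w0 pullback_in_V[OF \<tau> b] unfolding sign_pattern_def by (force dest!: bspec[of _ _ 1])
      finally show ?thesis by simp
    qed
    then have "(\<Sum>b\<in>B. f (pb \<tau> (b \<circ> ?t))) = - (\<Sum>b\<in>B. f (pb \<tau> b))" by (simp add: sum_negf)
    then show ?thesis using sum.reindex_bij_betw[OF bij_comp_B[OF t], of "\<lambda>b. f (pb \<tau> b)"] by simp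
  qed
  \<comment> \<open>A union bound over ordered pairs of distinct positions covers the maps that are
    not injective there. For these the average of f is bounded by its value at the maximizing
    u.\<close>
  define P where "P = {ij \<in> {1..2 * w} \<times> {1..2 * w}. fst ij \<noteq> snd ij}"
  have finP: "finite P" unfolding P_def by auto
  have "card P \<le> card ({1..2 * w} \<times> {1..2 * w})" unfolding P_def by (intro card_mono) auto
  then have cP: "real (card P) \<le> (2 * real w)\<^sup>2"
    using of_nat_mono[of "card P" "2 * w * (2 * w)", where 'a = real]
    by (simp add: card_cartesian_product power2_eq_square)
  let ?c = "\<lambda>\<tau> ij. if \<tau> (fst ij) = \<tau> (snd ij) then 1 else 0 :: real"
  have bd: "\<bar>\<Sum>b\<in>B. f (pb \<tau> b)\<bar> \<le> card B * \<bar>f u\<bar> * (\<Sum>ij\<in>P. ?c \<tau> ij)" if \<tau>: "\<tau> \<in> T" for \<tau>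
  proof (cases "inj_on \<tau> {1..2 * w}")
    case True
    then show ?thesis using zero[OF \<tau>] fu by (simp add: sum_nonneg)
  next
    case False
    then obtain i j where ij: "(i, j) \<in> P" "\<tau> i = \<tau> j" unfolding inj_on_def P_def by auto
    then have "?c \<tau> (i, j) \<le> (\<Sum>ij\<in>P. ?c \<tau> ij)" using finP by (intro member_le_sum) auto
    then have "1 \<le> (\<Sum>ij\<in>P. ?c \<tau> ij)" using ij by simp
    then have "card B * \<bar>f u\<bar> * 1 \<le> card B * \<bar>f u\<bar> * (\<Sum>ij\<in>P. ?c \<tau> ij)" by (intro mult_left_mono) auto
    moreover have "\<bar>\<Sum>b\<in>B. f (pb \<tau> b)\<bar> \<le> (\<Sum>b\<in>B. \<bar>f (pb \<tau> b)\<bar>)" by (rule sum_abs)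
    moreover have "(\<Sum>b\<in>B. \<bar>f (pb \<tau> b)\<bar>) \<le> card B * \<bar>f u\<bar>"
      using umax pullback_in_V[OF \<tau>] by (intro sum_bounded_above) auto
    ultimately show ?thesis by linarith
  qed
  let ?tot = "\<Sum>\<tau>\<in>T. \<Sum>a\<in>B. if pb \<tau> a = u then 1 else 0 :: real"
  have "\<bar>\<mu>\<bar> * \<bar>f u\<bar> = \<bar>step_weight * (\<Sum>\<tau>\<in>T. \<Sum>a\<in>B. if pb \<tau> a = u then (\<Sum>b\<in>B. f (pb \<tau> b)) else 0)\<bar>"
    using e u W_sum_right[of u f] unfolding eigenfunction_def by (metis abs_mult)
  also have "\<dots> = step_weight * \<bar>\<Sum>\<tau>\<in>T. \<Sum>a\<in>B. if pb \<tau> a = u then (\<Sum>b\<in>B. f (pb \<tau> b)) else 0\<bar>"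
    using step_weight_pos by (simp add: abs_mult)
  also have "\<dots> \<le> step_weight * (\<Sum>\<tau>\<in>T. \<Sum>a\<in>B. if pb \<tau> a = u then card B * \<bar>f u\<bar> * (\<Sum>ij\<in>P. ?c \<tau> ij) else 0)"
  proof -
    have "\<bar>\<Sum>\<tau>\<in>T. \<Sum>a\<in>B. if pb \<tau> a = u then (\<Sum>b\<in>B. f (pb \<tau> b)) else 0\<bar>
      \<le> (\<Sum>\<tau>\<in>T. \<bar>\<Sum>a\<in>B. if pb \<tau> a = u then (\<Sum>b\<in>B. f (pb \<tau> b)) else 0\<bar>)" by (rule sum_abs)
    also have "\<dots> \<le> (\<Sum>\<tau>\<in>T. \<Sum>a\<in>B. \<bar>if pb \<tau> a = u then (\<Sum>b\<in>B. f (pb \<tau> b)) else 0\<bar>)"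
      by (intro sum_mono sum_abs)
    also have "\<dots> \<le> (\<Sum>\<tau>\<in>T. \<Sum>a\<in>B. if pb \<tau> a = u then card B * \<bar>f u\<bar> * (\<Sum>ij\<in>P. ?c \<tau> ij) else 0)"
      using bd by (intro sum_mono) auto
    finally show ?thesis using step_weight_pos by (intro mult_left_mono) auto
  qed
  also have "(\<Sum>\<tau>\<in>T. \<Sum>a\<in>B. if pb \<tau> a = u then card B * \<bar>f u\<bar> * (\<Sum>ij\<in>P. ?c \<tau> ij) else 0)
    = card B * \<bar>f u\<bar> * (\<Sum>\<tau>\<in>T. \<Sum>a\<in>B. \<Sum>ij\<in>P. if pb \<tau> a = u \<and> \<tau> (fst ij) = \<tau> (snd ij) then 1 else 0)"
    unfolding sum_distrib_left by (intro sum.cong refl) (auto simp: sum_distrib_left intro!: sum.cong)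
  also have "(\<Sum>\<tau>\<in>T. \<Sum>a\<in>B. \<Sum>ij\<in>P. if pb \<tau> a = u \<and> \<tau> (fst ij) = \<tau> (snd ij) then 1 else 0 :: real)
    = (\<Sum>ij\<in>P. \<Sum>\<tau>\<in>T. \<Sum>a\<in>B. if pb \<tau> a = u \<and> \<tau> (fst ij) = \<tau> (snd ij) then 1 else 0)"
    by (rule sum_swap2[symmetric])
  also have "step_weight * (card B * \<bar>f u\<bar> * \<dots>) \<le> step_weight * (card B * \<bar>f u\<bar> * (\<Sum>ij\<in>P. (s - 1) / (m - 1) * ?tot))"
    using step_weight_pos w unfolding P_def
    by (intro mult_left_mono sum_mono same_block_count[OF u] mult_nonneg_nonneg) auto
  also have "\<dots> = \<bar>f u\<bar> * (card P * (real (s - 1) / real (m - 1)))"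
    using card_preimages[OF u] step_weight_pos card_B_pos by simp
  finally have "\<bar>f u\<bar> * \<bar>\<mu>\<bar> \<le> \<bar>f u\<bar> * (card P * (real (s - 1) / real (m - 1)))"
    by (simp only: mult.commute)
  then have "\<bar>\<mu>\<bar> \<le> card P * (real (s - 1) / real (m - 1))"
    using fu by (simp only: mult_le_cancel_left_pos)
  also have "\<dots> \<le> (2 * real w)\<^sup>2 * (real (s - 1) / real (m - 1))"
    using cP by (intro mult_right_mono) auto
  finally show ?thesis .
qed

end

section \<open>Contingency tables\<close>

lemma block_index:
  fixes i m r :: nat
  assumes "1 \<le> r" "r \<le> m"
  shows "(i * m + r - 1) div m = i" "(i * m + r - 1) mod m + 1 = r"
proof -
  obtain r' where "r = Suc r'" using assms(1) by (cases r) auto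
  then show "(i * m + r - 1) div m = i" "(i * m + r - 1) mod m + 1 = r" using assms(2) by auto
qed

text \<open>Position j = i * m + r is place r of block i, with blocks numbered from 0 and places
  from 1.\<close>

lemma card_block_concat:
  fixes m s :: nat
  assumes "m > 0"
  shows "card {j \<in> {1..s * m}. G ((j - 1) div m) ((j - 1) mod m + 1)} = (\<Sum>i<s. card {r \<in> {1..m}. G i r})"
proof -
  have "bij_betw (\<lambda>j. ((j - 1) div m, (j - 1) mod m + 1))
      {j \<in> {1..s * m}. G ((j - 1) div m) ((j - 1) mod m + 1)} (SIGMA i:{..<s}. {r \<in> {1..m}. G i r})"
  proof (rule bij_betwI[where g = "\<lambda>(i, r). i * m + r"], goal_cases)
    case 1
    show ?case
    proof (rule funcsetI)
      fix j assume "j \<in> {j \<in> {1..s * m}. G ((j - 1) div m) ((j - 1) mod m + 1)}"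
      then have j: "1 \<le> j" "j \<le> s * m" "G ((j - 1) div m) ((j - 1) mod m + 1)" by auto
      have "j - 1 < s * m" using j(1,2) by linarith
      then have "(j - 1) div m < s" by (simp add: less_mult_imp_div_less)
      moreover have "(j - 1) mod m < m" using assms by simp
      ultimately show "((j - 1) div m, (j - 1) mod m + 1) \<in> (SIGMA i:{..<s}. {r \<in> {1..m}. G i r})"
        using j(3) by auto
    qed
  next
    case 2
    have "i * m + r \<le> s * m" if "i < s" "r \<le> m" for i r
    proof -
      have "i * m + r \<le> Suc i * m" using that by simp
      also have "\<dots> \<le> s * m" using that by (intro mult_right_mono) auto
      finally show ?thesis .
    qed
    then show ?case using block_index by fastforce
  next
    case (3 j)
    then show ?case by simp
  next
    case (4 y)
    obtain i r where y: "y = (i, r)" by (cases y)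
    with 4 have r: "1 \<le> r" "r \<le> m" by auto
    show ?case unfolding y prod.case block_index[OF r] ..
  qed
  then have "card {j \<in> {1..s * m}. G ((j - 1) div m) ((j - 1) mod m + 1)} =
    card (SIGMA i:{..<s}. {r \<in> {1..m}. G i r})" by (rule bij_betw_same_card)
  then show ?thesis by simp
qed

section \<open>The method of types\<close>

lemma fact_mult_power_le: "fact k * k ^ t \<le> (fact t * k ^ k :: nat)"
proof (cases "t \<le> k")
  case True
  have "fact (t + d) \<le> (fact t * K ^ d :: nat)" if "t + d \<le> K" for d K
    using that
  proof (induction d)
    case (Suc d)
    then have "fact (t + d) \<le> (fact t * K ^ d :: nat)" "Suc (t + d) \<le> K" by auto
    then have "Suc (t + d) * fact (t + d) \<le> K * (fact t * K ^ d)" by (intro mult_mono) auto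
    then show ?case by (simp add: mult_ac)
  qed simp
  from this[of "k - t" k] have "fact k \<le> (fact t * k ^ (k - t) :: nat)" using True by simp
  then have "fact k * k ^ t \<le> fact t * k ^ (k - t) * k ^ t" by (rule mult_right_mono) simp
  also have "\<dots> = fact t * k ^ k" using True by (simp add: power_add[symmetric])
  finally show ?thesis .
next
  case False
  have "fact k * k ^ d \<le> (fact (k + d) :: nat)" for d
  proof (induction d)
    case (Suc d)
    have "k * (fact k * k ^ d) \<le> Suc (k + d) * fact (k + d)" using Suc by (intro mult_mono) auto
    then show ?case by (simp add: mult_ac)
  qed simp
  from this[of "t - k"] have "fact k * k ^ (t - k) \<le> (fact t :: nat)" using False by simp
  then have "fact k * k ^ (t - k) * k ^ k \<le> fact t * k ^ k" by (rule mult_right_mono) simp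
  then show ?thesis using False by (simp add: power_add[symmetric] mult.assoc)
qed

text \<open>The quotient k^t / t! is largest at t = k. Multiplying this over all letters, the powers
  of k cancel because the counts add up to |S| k, so the balanced multinomial coefficient is the
  largest.\<close>

lemma card_words_of_type_le:
  assumes S: "finite S" and t: "(\<Sum>c\<in>S. t c) = card S * k" and k: "k > 0"
  shows "card {y \<in> {1..card S * k} \<rightarrow>\<^sub>E S. \<forall>c\<in>S. card {i \<in> {1..card S * k}. y i = c} = t c}
    \<le> card (balanced_words S (card S * k) k)" (is "card ?Y \<le> card ?B")
proof -
  have Y: "card ?Y * (\<Prod>c\<in>S. fact (t c)) = fact (card S * k)"
    by (rule card_words_of_type[OF S t])
  have B: "card ?B * fact k ^ card S = fact (card S * k)"
    using card_words_of_type[OF S, of "\<lambda>_. k" "card S * k"] unfolding balanced_words_def by simp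
  have "(\<Prod>c\<in>S. fact k * k ^ t c) \<le> (\<Prod>c\<in>S. fact (t c) * k ^ k :: nat)"
    by (intro prod_mono) (auto intro: fact_mult_power_le)
  then have "fact k ^ card S * k ^ (card S * k) \<le> (\<Prod>c\<in>S. fact (t c)) * k ^ (card S * k)"
    by (simp add: prod.distrib power_sum[symmetric] t power_mult[symmetric] mult.commute)
  then have "fact k ^ card S \<le> (\<Prod>c\<in>S. fact (t c) :: nat)" using k by simp
  then have "card ?Y * fact k ^ card S \<le> card ?Y * (\<Prod>c\<in>S. fact (t c))" by simp
  also have "\<dots> = card ?B * fact k ^ card S" using Y B by simp
  finally show ?thesis by simp
qed

text \<open>The method of types: balanced words form the largest of the at most $(m+1)^{|S|}$ type classes.\<close>
lemma card_words_le_balanced: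
  assumes S: "finite S" and k: "k > 0"
  shows "card S ^ (card S * k) \<le> (card S * k + 1) ^ card S * card (balanced_words S (card S * k) k)"
proof -
  let ?m = "card S * k"
  let ?ty = "\<lambda>y. \<lambda>c\<in>S. card {i \<in> {1..?m}. y i = c}"
  let ?W = "{1..?m} \<rightarrow>\<^sub>E S"
  have fW: "finite ?W" using S by (intro finite_PiE) auto
  have "card S ^ ?m = card ?W" by (simp add: card_PiE)
  also have "\<dots> = (\<Sum>t\<in>?ty ` ?W. card {y \<in> ?W. ?ty y = t})"
    using sum.image_gen[OF fW, of "\<lambda>_. 1::nat" ?ty] by simp
  also have "\<dots> \<le> (\<Sum>t\<in>?ty ` ?W. card (balanced_words S ?m k))"
  proof (rule sum_mono)
    fix t assume "t \<in> ?ty ` ?W"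
    then obtain y where y: "y \<in> ?W" "t = ?ty y" by blast
    have "(\<Sum>c\<in>S. t c) = (\<Sum>c\<in>S. card {i \<in> {1..?m}. y i = c})" using y(2) by simp
    also have "\<dots> = card (\<Union>c\<in>S. {i \<in> {1..?m}. y i = c})"
      using S by (intro card_UN_disjoint[symmetric]) auto
    also have "(\<Union>c\<in>S. {i \<in> {1..?m}. y i = c}) = {1..?m}" using y(1) by auto
    finally have t: "(\<Sum>c\<in>S. t c) = ?m" by simp
    have "{y \<in> ?W. ?ty y = t} \<subseteq> {y \<in> ?W. \<forall>c\<in>S. card {i \<in> {1..?m}. y i = c} = t c}" by auto
    then have "card {y \<in> ?W. ?ty y = t} \<le> card {y \<in> ?W. \<forall>c\<in>S. card {i \<in> {1..?m}. y i = c} = t c}"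
      using fW by (intro card_mono) auto
    also have "\<dots> \<le> card (balanced_words S ?m k)" by (rule card_words_of_type_le[OF S t k])
    finally show "card {y \<in> ?W. ?ty y = t} \<le> card (balanced_words S ?m k)" .
  qed
  also have "\<dots> = card (?ty ` ?W) * card (balanced_words S ?m k)" by simp
  also have "card (?ty ` ?W) \<le> card (S \<rightarrow>\<^sub>E {0..?m})"
  proof (rule card_mono)
    show "finite (S \<rightarrow>\<^sub>E {0..?m})" using S by (intro finite_PiE) auto
    have "card {i \<in> {1..?m}. y i = c} \<le> ?m" for y :: "nat \<Rightarrow> 'a" and c
      by (rule order_trans[OF card_mono[of "{1..?m}"]]) auto
    then show "?ty ` ?W \<subseteq> S \<rightarrow>\<^sub>E {0..?m}" by auto
  qed
  then have "card (?ty ` ?W) * card (balanced_words S ?m k) \<le> (?m + 1) ^ card S * card (balanced_words S ?m k)"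
    using S by (intro mult_right_mono) (auto simp: card_PiE)
  finally show ?thesis .
qed

section \<open>Joint letter counts and their classes\<close>

definition table :: "nat \<Rightarrow> (nat \<Rightarrow> 'a) \<Rightarrow> (nat \<Rightarrow> 'a) \<Rightarrow> 'a \<times> 'a \<Rightarrow> nat" where
  "table r u v z = card {i \<in> {1..r}. (u i, v i) = z}"

lemma table_swap: "table r v u (y, x) = table r u v (x, y)"
  unfolding table_def by (intro arg_cong[of _ _ card]) auto

lemma table_comp: "p permutes {1..r} \<Longrightarrow> table r (u \<circ> p) (v \<circ> p) = table r u v"
  unfolding table_def fun_eq_iff using card_fibres_comp_permutes[of p "{1..r}" "\<lambda>i. (u i, v i) = z" for z] by simp

context balanced_walk begin

lemma V_outside: "u \<in> V \<Longrightarrow> i \<notin> {1..n} \<Longrightarrow> u i = undefined"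
  unfolding V_eq balanced_words_def by (auto simp: PiE_iff extensional_def)

text \<open>The table is a complete invariant for simultaneous permutation of a pair of words. Hence
  \<open>W\<close> is constant on pairs with the same table.\<close>

lemma table_transitive:
  assumes V: "u \<in> V" "v \<in> V" "u' \<in> V" "v' \<in> V" and eq: "table n u v = table n u' v'"
  obtains p where "p permutes {1..n}" "u = u' \<circ> p" "v = v' \<circ> p"
proof -
  have "card {i \<in> {1..n}. (u i, v i) = z} = card {i \<in> {1..n}. (u' i, v' i) = z}" for z
    using eq unfolding table_def fun_eq_iff by blast
  then obtain p where p: "p permutes {1..n}" "\<forall>i\<in>{1..n}. (u i, v i) = (u' (p i), v' (p i))"
    using equal_fibre_cards_permute[of "{1..n}" "\<lambda>i. (u i, v i)" "\<lambda>i. (u' i, v' i)"] by auto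
  have "u i = u' (p i) \<and> v i = v' (p i)" for i
    by (cases "i \<in> {1..n}") (use p V in \<open>simp_all add: V_outside permutes_not_in[OF p(1)]\<close>)
  then show thesis using that[OF p(1)] by (auto simp: fun_eq_iff)
qed

text \<open>By \<open>table_transitive\<close>, the size of the orbit of v under the stabilizer of
  u.\<close>

definition class_size :: "(nat \<Rightarrow> 'a) \<Rightarrow> (nat \<Rightarrow> 'a) \<Rightarrow> nat" where
  "class_size u v = card {v' \<in> V. table n u v' = table n u v}"

text \<open>Pulling back along any s-to-1 map multiplies a table by s, so these are the pairs whose
  pullbacks land in the class of (u, v), whatever the map.\<close>

definition lifting_pairs :: "(nat \<Rightarrow> 'a) \<Rightarrow> (nat \<Rightarrow> 'a) \<Rightarrow> ((nat \<Rightarrow> 'a) \<times> (nat \<Rightarrow> 'a)) set" where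
  "lifting_pairs u v = {(a, b) \<in> B \<times> B. \<forall>z. s * table m a b z = table n u v z}"

text \<open>The probability that a random pair (a, b) lands in the class, which is also the total
  weight of that class in a row of \<open>W\<close>.\<close>

definition class_mass :: "(nat \<Rightarrow> 'a) \<Rightarrow> (nat \<Rightarrow> 'a) \<Rightarrow> real" where
  "class_mass u v = card (lifting_pairs u v) / real (card B) ^ 2"

lemma table_pullback: "\<tau> \<in> T \<Longrightarrow> table n (pb \<tau> a) (pb \<tau> b) z = s * table m a b z"
proof -
  assume \<tau>: "\<tau> \<in> T"
  have "{i \<in> {1..n}. (pb \<tau> a i, pb \<tau> b i) = z} = {i \<in> {1..n}. (a (\<tau> i), b (\<tau> i)) = z}"
    by (auto simp: pullback_apply)
  then show ?thesis unfolding table_def using T_fibres[OF \<tau>, of "\<lambda>j. (a j, b j) = z"] by simp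
qed

lemma class_mass_sym: "class_mass u v = class_mass v u"
proof -
  have "bij_betw prod.swap (lifting_pairs u v) (lifting_pairs v u)"
    by (rule bij_betwI[where g = prod.swap])
      (auto simp: lifting_pairs_def; metis table_swap)+
  then show ?thesis unfolding class_mass_def by (simp add: bij_betw_same_card)
qed

lemma class_mass_le_1: "class_mass u v \<le> 1"
proof -
  have "card (lifting_pairs u v) \<le> card (B \<times> B)" unfolding lifting_pairs_def using finite_B by (intro card_mono) auto
  then show ?thesis unfolding class_mass_def using card_B_pos
    by (simp add: card_cartesian_product power2_eq_square divide_le_eq_1 flip: of_nat_mult)
qed

lemma class_size_pos: "v \<in> V \<Longrightarrow> class_size u v > 0"
  unfolding class_size_def using finite_V by (auto simp: card_gt_0_iff)

text \<open>Entries are constant on the class, so the left side is a partial row sum. By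
  transitivity this sum is the same in every row, and its average over rows is the probability that
  (a, b) lifts, which does not depend on \<tau>.\<close>

lemma row_class_mass:
  assumes u: "u \<in> V" and v: "v \<in> V"
  shows "W u v * class_size u v = class_mass u v"
proof -
  let ?\<theta> = "table n u v"
  let ?i = "\<lambda>u v. if table n u v = ?\<theta> then 1 else 0 :: real"
  have R: "(\<Sum>v'\<in>V. W u' v' * ?i u' v') = (\<Sum>v'\<in>V. W u v' * ?i u v')" if u': "u' \<in> V" for u'
  proof -
    obtain p where p: "p permutes {1..n}" "u' = u \<circ> p" using V_transitive[OF u' u] .
    have "(\<Sum>v'\<in>V. W u' v' * ?i u' v') = (\<Sum>v'\<in>V. W u' (v' \<circ> p) * ?i u' (v' \<circ> p))"
      by (rule sum.reindex_bij_betw[OF bij_comp_V[OF p(1)], symmetric])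
    then show ?thesis unfolding p(2) by (simp add: W_comp[OF p(1)] table_comp[OF p(1)])
  qed
  have "(\<Sum>v'\<in>V. W u v' * ?i u v') = (\<Sum>v'\<in>{v' \<in> V. table n u v' = ?\<theta>}. W u v)"
  proof -
    have "W u v' = W u v" if v': "v' \<in> V" "table n u v' = ?\<theta>" for v'
    proof -
      obtain p where p: "p permutes {1..n}" "u = u \<circ> p" "v' = v \<circ> p" using table_transitive[OF u v'(1) u v v'(2)] .
      then show ?thesis using W_comp[OF p(1), of u v] by simp
    qed
    then show ?thesis using finite_V by (intro sum.mono_neutral_cong_right) auto
  qed
  then have "W u v * class_size u v = (\<Sum>v'\<in>V. W u v' * ?i u v')" unfolding class_size_def by simp
  also have "card V * \<dots> = (\<Sum>u'\<in>V. \<Sum>v'\<in>V. W u' v' * ?i u' v')" using R by simp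
  also have "\<dots> = step_weight * (\<Sum>\<tau>\<in>T. \<Sum>a\<in>B. \<Sum>b\<in>B. ?i (pb \<tau> a) (pb \<tau> b))" by (rule W_sum_both)
  also have "(\<Sum>\<tau>\<in>T. \<Sum>a\<in>B. \<Sum>b\<in>B. ?i (pb \<tau> a) (pb \<tau> b)) = (\<Sum>\<tau>\<in>T. real (card (lifting_pairs u v)))"
  proof (rule sum.cong[OF refl])
    fix \<tau> assume \<tau>: "\<tau> \<in> T"
    have "(\<Sum>a\<in>B. \<Sum>b\<in>B. ?i (pb \<tau> a) (pb \<tau> b)) = (\<Sum>z\<in>B \<times> B. if z \<in> lifting_pairs u v then 1 else 0)"
    proof -
      have "table n (pb \<tau> a) (pb \<tau> b) = ?\<theta> \<longleftrightarrow> (a, b) \<in> lifting_pairs u v" if "a \<in> B" "b \<in> B" for a b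
        using that unfolding lifting_pairs_def fun_eq_iff table_pullback[OF \<tau>] by blast
      then show ?thesis unfolding sum.cartesian_product by (intro sum.cong refl) (clarsimp simp del: split_paired_All)
    qed
    also have "\<dots> = card (B \<times> B \<inter> lifting_pairs u v)" using finite_B by (simp add: sum.If_cases)
    also have "B \<times> B \<inter> lifting_pairs u v = lifting_pairs u v" unfolding lifting_pairs_def by auto
    finally show "(\<Sum>a\<in>B. \<Sum>b\<in>B. ?i (pb \<tau> a) (pb \<tau> b)) = card (lifting_pairs u v)" .
  qed
  finally show ?thesis unfolding step_weight_def class_mass_def using card_V_pos card_B_pos card_T_pos
    by (simp add: field_simps)
qed

lemma card_pair_class:
  assumes u: "u \<in> V" and v: "v \<in> V"
  shows "card {(u', v') \<in> V \<times> V. table n u' v' = table n u v} = card V * class_size u v"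
proof -
  have eq: "{(u', v') \<in> V \<times> V. table n u' v' = table n u v} = (SIGMA u':V. {v' \<in> V. table n u' v' = table n u v})" by auto
  have "card {v' \<in> V. table n u' v' = table n u v} = class_size u v" if u': "u' \<in> V" for u'
  proof -
    obtain p where p: "p permutes {1..n}" "u' = u \<circ> p" using V_transitive[OF u' u] .
    have "bij_betw (\<lambda>v. v \<circ> p) {v' \<in> V. table n u v' = table n u v} {v' \<in> V. table n u' v' = table n u v}"
    proof (rule bij_betw_subset[OF bij_comp_V[OF p(1)]])
      show "(\<lambda>v. v \<circ> p) ` {v' \<in> V. table n u v' = table n u v} = {v' \<in> V. table n u' v' = table n u v}"
      proof (intro equalityI subsetI)
        fix y assume "y \<in> {v' \<in> V. table n u' v' = table n u v}"
        then have y: "y \<in> V" "table n u' y = table n u v" by auto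
        then obtain z where "z \<in> V" "y = z \<circ> p" using bij_comp_V[OF p(1)] unfolding bij_betw_def by blast
        then show "y \<in> (\<lambda>v. v \<circ> p) ` {v' \<in> V. table n u v' = table n u v}"
          using y(2) unfolding p(2) by (simp add: table_comp[OF p(1)])
      qed (auto simp: p(2) table_comp[OF p(1)] comp_in_V[OF _ p(1)])
    qed auto
    then show ?thesis unfolding class_size_def by (rule bij_betw_same_card[symmetric])
  qed
  then show ?thesis unfolding eq using finite_V by simp
qed

text \<open>Concatenating $s$ pairs with the same contingency table multiplies the table by $s$.\<close>
lemma lifting_pairs_power_le:
  assumes u: "u \<in> V" and v: "v \<in> V"
  shows "card (lifting_pairs u v) ^ s \<le> card V * class_size u v"
proof -
  define cat where "cat F = (\<lambda>j\<in>{1..n}. F ((j - 1) div m) ((j - 1) mod m + 1))" for F :: "nat \<Rightarrow> nat \<Rightarrow> 'a"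
  define \<phi> where "\<phi> F = (cat (\<lambda>i. fst (F i)), cat (\<lambda>i. snd (F i)))" for F :: "nat \<Rightarrow> (nat \<Rightarrow> 'a) \<times> (nat \<Rightarrow> 'a)"
  have dom: "(j - 1) div m < s" "(j - 1) mod m + 1 \<in> {1..m}" if "j \<in> {1..n}" for j
  proof -
    have "j - 1 < s * m" using that unfolding n_eq by (auto intro: less_le_trans[of _ j])
    then show "(j - 1) div m < s" by (simp add: less_mult_imp_div_less)
    show "(j - 1) mod m + 1 \<in> {1..m}" using m_pos by (auto simp: Suc_le_eq)
  qed
  have catV: "cat F \<in> V" if F: "\<And>i. i < s \<Longrightarrow> F i \<in> B" for F
  proof -
    have "card {j \<in> {1..n}. cat F j = c} = m" if "c \<in> S" for c
    proof -
      have "{j \<in> {1..n}. cat F j = c} = {j \<in> {1..s * m}. F ((j - 1) div m) ((j - 1) mod m + 1) = c}"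
        unfolding cat_def n_eq by auto
      also have "card \<dots> = (\<Sum>i<s. card {r \<in> {1..m}. F i r = c})"
        by (rule card_block_concat[OF m_pos])
      also have "\<dots> = (\<Sum>i<s. k)" using F that unfolding balanced_words_def by (intro sum.cong) auto
      finally show ?thesis by (simp add: m_def)
    qed
    moreover have "cat F \<in> {1..n} \<rightarrow>\<^sub>E S"
      using F dom unfolding cat_def balanced_words_def by (auto simp: PiE_iff)
    ultimately show ?thesis unfolding V_eq balanced_words_def by blast
  qed
  have inj: "inj_on \<phi> ({..<s} \<rightarrow>\<^sub>E lifting_pairs u v)"
  proof (rule inj_onI)
    fix F G assume FG: "F \<in> {..<s} \<rightarrow>\<^sub>E lifting_pairs u v" "G \<in> {..<s} \<rightarrow>\<^sub>E lifting_pairs u v" "\<phi> F = \<phi> G"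
    have *: "fst (F i) r = fst (G i) r \<and> snd (F i) r = snd (G i) r" if "i < s" "r \<in> {1..m}" for i r
    proof -
      let ?j = "i * m + r"
      have "i * m + r \<le> Suc i * m" using that by simp
      also have "\<dots> \<le> s * m" using that by (intro mult_right_mono) auto
      finally have j: "?j \<in> {1..n}" using that unfolding n_eq by auto
      have d: "(?j - 1) div m = i" "(?j - 1) mod m + 1 = r"
        using block_index[of r m i] that by auto
      have "cat (\<lambda>i. fst (F i)) ?j = cat (\<lambda>i. fst (G i)) ?j" "cat (\<lambda>i. snd (F i)) ?j = cat (\<lambda>i. snd (G i)) ?j"
        using FG(3) unfolding \<phi>_def by auto
      then show ?thesis using j d unfolding cat_def by simp
    qed
    have **: "F i = G i" if i: "i < s" for i
    proof -
      have "fst (F i) \<in> B" "fst (G i) \<in> B" "snd (F i) \<in> B" "snd (G i) \<in> B"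
        using PiE_mem[OF FG(1), of i] PiE_mem[OF FG(2), of i] i unfolding lifting_pairs_def by (auto simp: case_prod_unfold)
      then have "fst (F i) r = fst (G i) r \<and> snd (F i) r = snd (G i) r" for r
        using *[OF i, of r] unfolding balanced_words_def by (cases "r \<in> {1..m}") (auto simp: PiE_iff extensional_def)
      then show ?thesis by (auto simp: prod_eq_iff fun_eq_iff)
    qed
    show "F = G" using FG(1,2) ** by (intro PiE_ext[OF FG(1,2)]) auto
  qed
  have "\<phi> ` ({..<s} \<rightarrow>\<^sub>E lifting_pairs u v) \<subseteq> {(u', v') \<in> V \<times> V. table n u' v' = table n u v}"
  proof (rule image_subsetI)
    fix F assume F: "F \<in> {..<s} \<rightarrow>\<^sub>E lifting_pairs u v"
    have FB: "fst (F i) \<in> B" "snd (F i) \<in> B" and Ft: "\<And>z. s * table m (fst (F i)) (snd (F i)) z = table n u v z" if "i < s" for i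
      using PiE_mem[OF F, of i] that unfolding lifting_pairs_def by (auto simp: case_prod_unfold)
    have "table n (cat (\<lambda>i. fst (F i))) (cat (\<lambda>i. snd (F i))) z = table n u v z" for z
    proof -
      have "{j \<in> {1..n}. (cat (\<lambda>i. fst (F i)) j, cat (\<lambda>i. snd (F i)) j) = z} =
        {j \<in> {1..s * m}. (fst (F ((j - 1) div m)) ((j - 1) mod m + 1), snd (F ((j - 1) div m)) ((j - 1) mod m + 1)) = z}"
        unfolding cat_def n_eq by auto
      then have "table n (cat (\<lambda>i. fst (F i))) (cat (\<lambda>i. snd (F i))) z = (\<Sum>i<s. table m (fst (F i)) (snd (F i)) z)"
        unfolding table_def using card_block_concat[OF m_pos, of s "\<lambda>i r. (fst (F i) r, snd (F i) r) = z"] by simp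
      \<comment> \<open>A lifting pair is described only through s times its table; adding the s
        blocks makes up for exactly that factor.\<close>
      then have "s * table n (cat (\<lambda>i. fst (F i))) (cat (\<lambda>i. snd (F i))) z = (\<Sum>i<s. table n u v z)"
        by (simp add: sum_distrib_left Ft)
      then show ?thesis using s_ge by simp
    qed
    then show "\<phi> F \<in> {(u', v') \<in> V \<times> V. table n u' v' = table n u v}"
      unfolding \<phi>_def using catV FB by auto
  qed
  moreover have "finite {(u', v') \<in> V \<times> V. table n u' v' = table n u v}"
    using finite_V by (auto intro: finite_subset[of _ "V \<times> V"])
  ultimately have "card ({..<s} \<rightarrow>\<^sub>E lifting_pairs u v) \<le> card {(u', v') \<in> V \<times> V. table n u' v' = table n u v}"
    by (rule card_inj_on_le[OF inj])
  then show ?thesis unfolding card_pair_class[OF u v] by (simp add: card_PiE)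
qed

text \<open>A word of length n splits into s words of length m, and for each of these the balanced
  words are all words up to a polynomial factor.\<close>

lemma card_V_le: "card V \<le> (m + 1) ^ s\<^sup>2 * card B ^ s"
proof -
  have "card V \<le> card ({1..n} \<rightarrow>\<^sub>E S)"
    using finite_S unfolding V_eq balanced_words_def by (intro card_mono finite_PiE) auto
  also have "\<dots> = (s ^ m) ^ s" by (simp add: card_PiE card_S n_eq power_mult[symmetric] mult.commute)
  also have "\<dots> \<le> ((m + 1) ^ s * card B) ^ s"
    using card_words_le_balanced[OF finite_S, of k] k_ge unfolding card_S m_def by (intro power_mono) auto
  finally show ?thesis by (simp add: power_mult_distrib power_mult[symmetric] power2_eq_square)
qed

section \<open>Heavy and light entries of the walk matrix\<close>

lemma heavy_entry_bound:
  assumes u: "u \<in> V" and v: "v \<in> V" and \<epsilon>: "0 < \<epsilon>" "\<epsilon> \<le> class_mass u v"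
  shows "W u v \<le> (real m + 1) ^ (2 * s\<^sup>2) / \<epsilon> ^ s / card V"
proof -
  let ?M = "real (card B)" and ?N = "real (card V)" and ?class_size = "real (class_size u v)"
  have class_size: "?class_size > 0" using class_size_pos[OF v] by simp
  have M: "?M > 0" using card_B_pos by simp
  have N: "?N > 0" using card_V_pos by simp
  \<comment> \<open>Mass \<epsilon> means at least \<epsilon> |B|^2 lifting pairs. Their s-fold
    concatenations make N times the class size at least \<epsilon>^s |B|^(2s), which is comparable
    with \<epsilon>^s N^2. Since the class has total mass at most 1, each entry is at most the
    inverse of its size.\<close>
  have "\<epsilon> ^ s \<le> class_mass u v ^ s" using \<epsilon> by (intro power_mono) auto
  also have "\<dots> = real (card (lifting_pairs u v) ^ s) / (?M ^ 2) ^ s" unfolding class_mass_def by (simp add: power_divide)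
  also have "\<dots> \<le> real (card V * class_size u v) / (?M ^ 2) ^ s"
    using lifting_pairs_power_le[OF u v] by (intro divide_right_mono) (simp_all only: of_nat_le_iff, simp)
  finally have 1: "\<epsilon> ^ s * (?M ^ s)\<^sup>2 \<le> ?N * ?class_size"
    using M by (simp add: field_simps power_mult[symmetric] mult.commute)
  have "?N \<le> (real m + 1) ^ s\<^sup>2 * ?M ^ s"
    using card_V_le of_nat_mono[of "card V" "(m + 1) ^ s\<^sup>2 * card B ^ s", where 'a = real] by (simp add: add.commute)
  then have "?N\<^sup>2 \<le> ((real m + 1) ^ s\<^sup>2 * ?M ^ s)\<^sup>2" by (intro power_mono) auto
  then have 2: "?N\<^sup>2 \<le> (real m + 1) ^ (2 * s\<^sup>2) * (?M ^ s)\<^sup>2"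
    by (simp add: power_mult_distrib power_mult[symmetric] mult.commute)
  have "\<epsilon> ^ s * ?N\<^sup>2 \<le> \<epsilon> ^ s * ((real m + 1) ^ (2 * s\<^sup>2) * (?M ^ s)\<^sup>2)"
    using 2 \<epsilon> by (intro mult_left_mono) auto
  also have "\<dots> = (real m + 1) ^ (2 * s\<^sup>2) * (\<epsilon> ^ s * (?M ^ s)\<^sup>2)" by simp
  also have "\<dots> \<le> (real m + 1) ^ (2 * s\<^sup>2) * (?N * ?class_size)" using 1 by (intro mult_left_mono) auto
  finally have "\<epsilon> ^ s * ?N * ?N \<le> (real m + 1) ^ (2 * s\<^sup>2) * ?class_size * ?N"
    by (simp add: power2_eq_square mult_ac)
  then have 3: "\<epsilon> ^ s * ?N \<le> (real m + 1) ^ (2 * s\<^sup>2) * ?class_size" using N by simp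
  have "W u v * ?class_size \<le> 1" using row_class_mass[OF u v] class_mass_le_1[of u v] by simp
  then have "W u v \<le> 1 / ?class_size" using class_size by (simp add: field_simps)
  also have "\<dots> \<le> (real m + 1) ^ (2 * s\<^sup>2) / (\<epsilon> ^ s * ?N)"
    using 3 class_size N \<epsilon> by (simp add: field_simps)
  finally show ?thesis by simp
qed

text \<open>Each class contributes exactly 1, so the sum counts the tables that occur, which have
  s^2 relevant entries between 0 and n.\<close>

lemma sum_inverse_class_size_le:
  assumes "u \<in> V"
  shows "(\<Sum>v\<in>V. 1 / real (class_size u v)) \<le> (real n + 1) ^ s\<^sup>2"
proof -
  let ?t = "table n u"
  have "(\<Sum>v\<in>V. 1 / real (class_size u v)) = (\<Sum>\<theta>\<in>?t ` V. \<Sum>v\<in>{v \<in> V. ?t v = \<theta>}. 1 / real (class_size u v))"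
    by (rule sum.image_gen[OF finite_V])
  also have "\<dots> = (\<Sum>\<theta>\<in>?t ` V. 1)"
  proof (intro sum.cong refl)
    fix \<theta> assume "\<theta> \<in> ?t ` V"
    then obtain v0 where v0: "v0 \<in> V" "\<theta> = ?t v0" by blast
    have "(\<Sum>v\<in>{v \<in> V. ?t v = \<theta>}. 1 / real (class_size u v)) = (\<Sum>v\<in>{v \<in> V. ?t v = \<theta>}. 1 / real (class_size u v0))"
      unfolding class_size_def v0(2) by (intro sum.cong refl) auto
    also have "\<dots> = real (class_size u v0) * (1 / real (class_size u v0))" unfolding class_size_def v0(2) by simp
    finally show "(\<Sum>v\<in>{v \<in> V. ?t v = \<theta>}. 1 / real (class_size u v)) = 1" using class_size_pos[OF v0(1), of u] by simp
  qed
  also have "\<dots> = card (?t ` V)" by simp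
  also have "card (?t ` V) \<le> card (S \<times> S \<rightarrow>\<^sub>E {0..n})"
  proof (rule card_inj_on_le[where f = "\<lambda>\<theta>. restrict \<theta> (S \<times> S)"])
    have out: "table n u v z = 0" if "v \<in> V" "z \<notin> S \<times> S" for v z
    proof -
      have "u i \<in> S \<and> v i \<in> S" if "i \<in> {1..n}" for i
        using assms \<open>v \<in> V\<close> that unfolding V_eq balanced_words_def by auto
      then have "{i \<in> {1..n}. (u i, v i) = z} = {}" using that(2) by auto
      then show ?thesis unfolding table_def by (metis card.empty)
    qed
    show "inj_on (\<lambda>\<theta>. restrict \<theta> (S \<times> S)) (?t ` V)"
    proof (rule inj_onI)
      fix \<theta> \<theta>' assume a: "\<theta> \<in> ?t ` V" "\<theta>' \<in> ?t ` V" "restrict \<theta> (S \<times> S) = restrict \<theta>' (S \<times> S)"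
      show "\<theta> = \<theta>'"
      proof
        fix z show "\<theta> z = \<theta>' z"
        proof (cases "z \<in> S \<times> S")
          case True then show ?thesis using a(3) by (metis restrict_apply')
        next
          case False then show ?thesis using a(1,2) out[OF _ False] by auto
        qed
      qed
    qed
    have "table n u v z \<le> n" for v z
      unfolding table_def by (rule order_trans[OF card_mono[of "{1..n}"]]) auto
    then show "(\<lambda>\<theta>. restrict \<theta> (S \<times> S)) ` ?t ` V \<subseteq> S \<times> S \<rightarrow>\<^sub>E {0..n}"
      by (intro image_subsetI) (simp only: restrict_PiE_iff, auto)
    show "finite (S \<times> S \<rightarrow>\<^sub>E {0..n})" using finite_S by (intro finite_PiE) auto
  qed
  also have "card (S \<times> S \<rightarrow>\<^sub>E {0..n}) = (n + 1) ^ s\<^sup>2"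
    using finite_S by (simp add: card_PiE card_cartesian_product card_S power2_eq_square)
  finally show ?thesis by (simp add: add.commute)
qed

text \<open>A light entry is its class mass divided by its class size, hence below \<epsilon> over
  the class size.\<close>

lemma light_row_bound:
  assumes u: "u \<in> V" and \<epsilon>: "0 \<le> \<epsilon>"
  shows "(\<Sum>v\<in>V. if class_mass u v < \<epsilon> then W u v else 0) \<le> \<epsilon> * (real n + 1) ^ s\<^sup>2"
proof -
  have "(\<Sum>v\<in>V. if class_mass u v < \<epsilon> then W u v else 0) \<le> (\<Sum>v\<in>V. \<epsilon> * (1 / real (class_size u v)))"
  proof (rule sum_mono)
    fix v assume v: "v \<in> V"
    have "W u v * class_size u v = class_mass u v" by (rule row_class_mass[OF u v])
    then show "(if class_mass u v < \<epsilon> then W u v else 0) \<le> \<epsilon> * (1 / real (class_size u v))"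
      using class_size_pos[OF v, of u] \<epsilon> by (auto simp: field_simps)
  qed
  also have "\<dots> = \<epsilon> * (\<Sum>v\<in>V. 1 / real (class_size u v))" by (simp add: sum_distrib_left)
  also have "\<dots> \<le> \<epsilon> * (real n + 1) ^ s\<^sup>2" using sum_inverse_class_size_le[OF u] \<epsilon> by (intro mult_left_mono)
  finally show ?thesis .
qed

end

section \<open>Eigenfunctions of high degree\<close>

lemma bessel_inequality:
  fixes g :: "'v \<Rightarrow> real" and f :: "'i \<Rightarrow> 'v \<Rightarrow> real"
  assumes I: "finite I" and V: "finite V"
    and orth: "\<And>i j. i \<in> I \<Longrightarrow> j \<in> I \<Longrightarrow> i \<noteq> j \<Longrightarrow> (\<Sum>v\<in>V. f i v * f j v) = 0"
    and pos: "\<And>i. i \<in> I \<Longrightarrow> (\<Sum>v\<in>V. (f i v)\<^sup>2) > 0"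
  shows "(\<Sum>i\<in>I. (\<Sum>v\<in>V. g v * f i v)\<^sup>2 / (\<Sum>v\<in>V. (f i v)\<^sup>2)) \<le> (\<Sum>v\<in>V. (g v)\<^sup>2)"
proof -
  define q where "q i = (\<Sum>v\<in>V. (f i v)\<^sup>2)" for i
  define a where "a i = (\<Sum>v\<in>V. g v * f i v)" for i
  define c where "c i = a i / q i" for i
  define h where "h v = (\<Sum>i\<in>I. c i * f i v)" for v
  have gh: "(\<Sum>v\<in>V. g v * h v) = (\<Sum>i\<in>I. c i * a i)"
    unfolding h_def a_def sum_distrib_left by (subst sum.swap) (simp add: mult_ac)
  have hh: "(\<Sum>v\<in>V. (h v)\<^sup>2) = (\<Sum>i\<in>I. c i * a i)"
  proof -
    have "(\<Sum>v\<in>V. (h v)\<^sup>2) = (\<Sum>v\<in>V. \<Sum>i\<in>I. \<Sum>j\<in>I. c i * c j * (f i v * f j v))"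
      by (simp add: h_def power2_eq_square sum_product mult_ac)
    also have "\<dots> = (\<Sum>i\<in>I. \<Sum>j\<in>I. \<Sum>v\<in>V. c i * c j * (f i v * f j v))" by (rule sum_swap2)
    also have "\<dots> = (\<Sum>i\<in>I. \<Sum>j\<in>I. c i * c j * (\<Sum>v\<in>V. f i v * f j v))" by (simp add: sum_distrib_left)
    also have "\<dots> = (\<Sum>i\<in>I. \<Sum>j\<in>I. if j = i then c i * c i * q i else 0)"
      by (intro sum.cong refl) (auto simp: orth q_def power2_eq_square)
    also have "\<dots> = (\<Sum>i\<in>I. c i * a i)"
    proof (intro sum.cong refl)
      fix i assume "i \<in> I"
      then show "(\<Sum>j\<in>I. if j = i then c i * c i * q i else 0) = c i * a i"
        using I pos[of i] unfolding q_def[symmetric] by (simp add: c_def)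
    qed
    finally show ?thesis .
  qed
  have "0 \<le> (\<Sum>v\<in>V. (g v - h v)\<^sup>2)" by (intro sum_nonneg) auto
  also have "\<dots> = (\<Sum>v\<in>V. (g v)\<^sup>2) - 2 * (\<Sum>v\<in>V. g v * h v) + (\<Sum>v\<in>V. (h v)\<^sup>2)"
    by (simp add: power2_diff sum.distrib sum_subtractf sum_distrib_left mult.assoc)
  finally have "(\<Sum>i\<in>I. c i * a i) \<le> (\<Sum>v\<in>V. (g v)\<^sup>2)" using gh hh by simp
  then show ?thesis unfolding c_def a_def q_def by (simp add: power2_eq_square)
qed

text \<open>Cauchy-Schwarz with the weight split as two square roots; by symmetry the row bound
  serves for the columns as well. It converts the light row sums into a bound in the Euclidean
  norm.\<close>

lemma schur_test:
  fixes w :: "'v \<Rightarrow> 'v \<Rightarrow> real"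
  assumes V: "finite V" and sym: "\<And>u v. u \<in> V \<Longrightarrow> v \<in> V \<Longrightarrow> w u v = w v u"
    and nn: "\<And>u v. u \<in> V \<Longrightarrow> v \<in> V \<Longrightarrow> 0 \<le> w u v"
    and row: "\<And>u. u \<in> V \<Longrightarrow> (\<Sum>v\<in>V. w u v) \<le> \<delta>"
  shows "(\<Sum>u\<in>V. (\<Sum>v\<in>V. w u v * f v)\<^sup>2) \<le> \<delta>\<^sup>2 * (\<Sum>v\<in>V. (f v)\<^sup>2)"
proof -
  have CS: "(\<Sum>v\<in>V. w u v * f v)\<^sup>2 \<le> \<delta> * (\<Sum>v\<in>V. w u v * (f v)\<^sup>2)" if u: "u \<in> V" for u
  proof -
    have "(\<Sum>v\<in>V. w u v * f v) = (\<Sum>v\<in>V. sqrt (w u v) * (sqrt (w u v) * f v))"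
      using nn[OF u] by (intro sum.cong refl) (simp add: mult.assoc[symmetric])
    then have "(\<Sum>v\<in>V. w u v * f v)\<^sup>2 \<le> (\<Sum>v\<in>V. (sqrt (w u v))\<^sup>2) * (\<Sum>v\<in>V. (sqrt (w u v) * f v)\<^sup>2)"
      using Cauchy_Schwarz_ineq_sum by metis
    also have "\<dots> = (\<Sum>v\<in>V. w u v) * (\<Sum>v\<in>V. w u v * (f v)\<^sup>2)"
      using nn[OF u] by (simp add: power_mult_distrib)
    also have "\<dots> \<le> \<delta> * (\<Sum>v\<in>V. w u v * (f v)\<^sup>2)"
      using row[OF u] nn[OF u] by (intro mult_right_mono sum_nonneg) auto
    finally show ?thesis .
  qed
  have "(\<Sum>u\<in>V. (\<Sum>v\<in>V. w u v * f v)\<^sup>2) \<le> \<delta> * (\<Sum>u\<in>V. \<Sum>v\<in>V. w u v * (f v)\<^sup>2)"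
    unfolding sum_distrib_left[of \<delta>] by (intro sum_mono) (use CS in \<open>simp add: sum_distrib_left\<close>)
  also have "(\<Sum>u\<in>V. \<Sum>v\<in>V. w u v * (f v)\<^sup>2) = (\<Sum>v\<in>V. (\<Sum>u\<in>V. w v u) * (f v)\<^sup>2)"
    by (subst sum.swap) (simp add: sum_distrib_right sym)
  also have "\<delta> * \<dots> \<le> \<delta> * (\<Sum>v\<in>V. \<delta> * (f v)\<^sup>2)"
  proof (cases "V = {}")
    case False
    then obtain u where "u \<in> V" by blast
    then have "0 \<le> \<delta>" using row nn by (meson order_trans sum_nonneg)
    then show ?thesis using row by (intro mult_left_mono sum_mono mult_right_mono) auto
  qed simp
  finally show ?thesis by (simp add: sum_distrib_left power2_eq_square mult_ac)
qed

context balanced_walk begin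

text \<open>Once the light part is removed, the heavy part still stretches each eigenfunction by at
  least \<mu> - \<delta>. Bessel in every row bounds the sum of these squared factors by the squared
  Hilbert-Schmidt norm of the heavy part.\<close>

lemma many_orthogonal_eigenfunctions_bound:
  assumes I: "finite I" and e: "\<And>i. i \<in> I \<Longrightarrow> eigenfunction \<mu> (f i)"
    and orth: "\<And>i j. i \<in> I \<Longrightarrow> j \<in> I \<Longrightarrow> i \<noteq> j \<Longrightarrow> (\<Sum>v\<in>V. f i v * f j v) = 0"
    and \<epsilon>: "0 < \<epsilon>" and \<mu>: "\<epsilon> * (real n + 1) ^ s\<^sup>2 \<le> \<mu>"
  shows "card I * (\<mu> - \<epsilon> * (real n + 1) ^ s\<^sup>2)\<^sup>2 \<le> (real m + 1) ^ (2 * s\<^sup>2) / \<epsilon> ^ s"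
proof -
  define \<delta> where "\<delta> = \<epsilon> * (real n + 1) ^ s\<^sup>2"
  define H where "H = (real m + 1) ^ (2 * s\<^sup>2) / \<epsilon> ^ s"
  have H0: "H \<ge> 0" unfolding H_def using \<epsilon> by simp
  have \<delta>0: "\<delta> \<ge> 0" unfolding \<delta>_def using \<epsilon> by simp
  define Wl where "Wl u v = (if class_mass u v < \<epsilon> then W u v else 0)" for u v
  define Wh where "Wh u v = (if class_mass u v < \<epsilon> then 0 else W u v)" for u v
  have split: "W u v = Wh u v + Wl u v" for u v unfolding Wl_def Wh_def by simp
  have heavy: "Wh u v \<le> H / card V" if "u \<in> V" "v \<in> V" for u v
    unfolding Wh_def H_def using heavy_entry_bound[OF that \<epsilon>] \<epsilon> by simp
  have Wh0: "Wh u v \<ge> 0" for u v unfolding Wh_def using W_nonneg by simp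
  have low: "(\<mu> - \<delta>)\<^sup>2 * (\<Sum>u\<in>V. (f i u)\<^sup>2) \<le> (\<Sum>u\<in>V. (\<Sum>v\<in>V. Wh u v * f i v)\<^sup>2)" if i: "i \<in> I" for i
  proof -
    let ?q = "L2_set (f i) V"
    have "\<mu> * f i u = (\<Sum>v\<in>V. Wh u v * f i v) + (\<Sum>v\<in>V. Wl u v * f i v)" if "u \<in> V" for u
      using e[OF i] that unfolding eigenfunction_def by (simp add: split distrib_right sum.distrib)
    then have "L2_set (\<lambda>u. \<mu> * f i u) V = L2_set (\<lambda>u. (\<Sum>v\<in>V. Wh u v * f i v) + (\<Sum>v\<in>V. Wl u v * f i v)) V"
      by (intro L2_set_cong) auto
    also have "\<dots> \<le> L2_set (\<lambda>u. \<Sum>v\<in>V. Wh u v * f i v) V + L2_set (\<lambda>u. \<Sum>v\<in>V. Wl u v * f i v) V"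
      by (rule L2_set_triangle_ineq)
    also have "L2_set (\<lambda>u. \<Sum>v\<in>V. Wl u v * f i v) V \<le> \<delta> * ?q"
    proof -
      have "(\<Sum>u\<in>V. (\<Sum>v\<in>V. Wl u v * f i v)\<^sup>2) \<le> \<delta>\<^sup>2 * (\<Sum>v\<in>V. (f i v)\<^sup>2)"
      proof (rule schur_test[OF finite_V])
        show "Wl u v = Wl v u" for u v unfolding Wl_def using class_mass_sym[of u v] W_sym[of u v] by simp
        show "0 \<le> Wl u v" for u v unfolding Wl_def using W_nonneg by simp
        show "(\<Sum>v\<in>V. Wl u v) \<le> \<delta>" if "u \<in> V" for u
          unfolding Wl_def \<delta>_def using light_row_bound[OF that] \<epsilon> by simp
      qed
      then have "sqrt (\<Sum>u\<in>V. (\<Sum>v\<in>V. Wl u v * f i v)\<^sup>2) \<le> sqrt (\<delta>\<^sup>2 * (\<Sum>v\<in>V. (f i v)\<^sup>2))"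
        by (rule real_sqrt_le_mono)
      then show ?thesis using \<delta>0 unfolding L2_set_def by (simp add: real_sqrt_mult)
    qed
    finally have "(\<mu> - \<delta>) * ?q \<le> L2_set (\<lambda>u. \<Sum>v\<in>V. Wh u v * f i v) V"
      using eigenfunction_nonneg[OF e[OF i]] by (simp add: L2_set_right_distrib[symmetric] algebra_simps)
    then have "((\<mu> - \<delta>) * ?q)\<^sup>2 \<le> (L2_set (\<lambda>u. \<Sum>v\<in>V. Wh u v * f i v) V)\<^sup>2"
      using \<mu> unfolding \<delta>_def by (intro power_mono) (auto intro!: mult_nonneg_nonneg)
    then show ?thesis unfolding L2_set_def power_mult_distrib by (simp add: sum_nonneg)
  qed
  have "card I * (\<mu> - \<delta>)\<^sup>2 = (\<Sum>i\<in>I. (\<mu> - \<delta>)\<^sup>2)" by simp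
  also have "\<dots> \<le> (\<Sum>i\<in>I. (\<Sum>u\<in>V. (\<Sum>v\<in>V. Wh u v * f i v)\<^sup>2) / (\<Sum>v\<in>V. (f i v)\<^sup>2))"
    using low norm_pos[OF e] by (intro sum_mono) (simp add: pos_le_divide_eq)
  also have "\<dots> = (\<Sum>u\<in>V. \<Sum>i\<in>I. (\<Sum>v\<in>V. Wh u v * f i v)\<^sup>2 / (\<Sum>v\<in>V. (f i v)\<^sup>2))"
    by (subst sum.swap) (simp add: sum_divide_distrib)
  also have "\<dots> \<le> (\<Sum>u\<in>V. \<Sum>v\<in>V. (Wh u v)\<^sup>2)"
    by (intro sum_mono bessel_inequality[OF I finite_V]) (auto intro: orth norm_pos e)
  \<comment> \<open>In each square one factor is replaced by the entry bound H / |V|, and the other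
    is summed along a row of \<open>W\<close> to 1.\<close>
  also have "\<dots> \<le> (\<Sum>u\<in>V. \<Sum>v\<in>V. H / card V * Wh u v)"
    unfolding power2_eq_square using heavy Wh0 by (intro sum_mono mult_right_mono) auto
  also have "\<dots> \<le> (\<Sum>u\<in>V. \<Sum>v\<in>V. H / card V * W u v)"
    using H0 W_nonneg by (intro sum_mono mult_left_mono) (auto simp: Wh_def)
  also have "\<dots> = (\<Sum>u\<in>V. H / card V)"
    by (intro sum.cong refl) (simp only: sum_distrib_left[symmetric] W_row_sum mult_1_right)
  also have "\<dots> = H" using card_V_pos by simp
  finally show ?thesis unfolding \<delta>_def H_def .
qed

section \<open>From one sign pattern to many\<close>

lemma sign_pattern_extend_symmetric:
  assumes e: "eigenfunction \<mu> f" and pt: "sign_pattern q \<epsilon> f" and \<epsilon>: "\<epsilon> (Suc q) = 1" and q: "2 * q + s < n"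
  shows "\<exists>f'. eigenfunction \<mu> f' \<and> sign_pattern (Suc q) \<epsilon> f'"
proof -
  obtain u where u: "u \<in> V" "f u \<noteq> 0" using e unfolding eigenfunction_def by blast
  \<comment> \<open>Pigeonhole: more than s positions remain, so two of them carry the same letter
    in u. Exchanging these fixes u, and the symmetrized function has value 2 f(u) there.\<close>
  have "card (u ` {2 * q + 1..n}) \<le> card S"
    using u(1) finite_S unfolding V_eq balanced_words_def by (intro card_mono) (auto simp: PiE_iff)
  also have "\<dots> < card {2 * q + 1..n}" using q card_S by simp
  finally have "\<not> inj_on u {2 * q + 1..n}" by (metis card_image less_irrefl)
  then obtain i j where ij: "i \<in> {2 * q + 1..n}" "j \<in> {2 * q + 1..n}" "i \<noteq> j" "u i = u j"
    unfolding inj_on_def by blast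
  have "u \<circ> Transposition.transpose i j = u" using ij(4) by (auto simp: fun_eq_iff Transposition.transpose_def)
  then have "f u + \<epsilon> (Suc q) * f (u \<circ> Transposition.transpose i j) \<noteq> 0" using u \<epsilon> by simp
  then show ?thesis using sign_pattern_extend[OF e pt ij(1-3)] u(1) \<epsilon> by auto
qed

text \<open>The action of p on consecutive pairs of positions that keeps the order within each pair:
  a copy of the permutations of {1..q} among those of {1..n}.\<close>

definition double_perm :: "nat \<Rightarrow> (nat \<Rightarrow> nat) \<Rightarrow> nat \<Rightarrow> nat" where
  "double_perm q p j = (if j \<in> {1..2 * q} then if even j then 2 * p (j div 2) else 2 * p (Suc j div 2) - 1 else j)"

lemma double_perm_simps:
  assumes "i \<in> {1..q}"
  shows "double_perm q p (2 * i) = 2 * p i" "double_perm q p (2 * i - 1) = 2 * p i - 1"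
proof -
  obtain j where "i = Suc j" using assms by (cases i) auto
  then show "double_perm q p (2 * i) = 2 * p i" "double_perm q p (2 * i - 1) = 2 * p i - 1"
    using assms unfolding double_perm_def by auto
qed

lemma double_perm_inverse:
  assumes "p permutes {1..q}" shows "double_perm q (inv_into UNIV p) (double_perm q p j) = j"
proof (cases "j \<in> {1..2 * q}")
  case True
  have pin: "p i \<in> {1..q}" if "i \<in> {1..q}" for i using permutes_in_image[OF assms] that by blast
  have ip: "inv_into UNIV p (p i) = i" for i using permutes_inverses[OF assms] by simp
  show ?thesis
  proof (cases "even j")
    case True
    then obtain i where i: "j = 2 * i" by blast
    then have "i \<in> {1..q}" using \<open>j \<in> {1..2 * q}\<close> by auto
    then show ?thesis unfolding i using pin by (simp add: double_perm_simps ip del: atLeastAtMost_iff)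
  next
    case False
    then obtain i where i: "j = 2 * i - 1" "i \<in> {1..q}"
      using \<open>j \<in> {1..2 * q}\<close> by (intro that[of "Suc j div 2"]) (auto elim!: oddE)
    show ?thesis unfolding i(1) double_perm_simps(2)[OF i(2)] double_perm_simps(2)[OF pin[OF i(2)]] ip ..
  qed
next
  case False
  then show ?thesis by (auto simp: double_perm_def)
qed

lemma double_perm_permutes:
  assumes p: "p permutes {1..q}" and q: "2 * q \<le> n" shows "double_perm q p permutes {1..n}"
proof -
  have "double_perm q p (double_perm q (inv_into UNIV p) j) = j" for j
    using double_perm_inverse[OF permutes_inv[OF p]] permutes_inv_inv[OF p] by simp
  then have "bij (double_perm q p)"
    using double_perm_inverse[OF p]
    by (intro o_bij[where g = "double_perm q (inv_into UNIV p)"]) (auto simp: fun_eq_iff)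
  moreover have "double_perm q p j = j" if "j \<notin> {1..n}" for j using that q unfolding double_perm_def by auto
  ultimately show ?thesis unfolding permutes_def bij_iff by blast
qed

lemma sign_pattern_permute:
  assumes e: "eigenfunction \<mu> f" and pt: "sign_pattern q \<epsilon> f" and p: "p permutes {1..q}" and q: "2 * q \<le> n"
  shows "\<exists>f'. eigenfunction \<mu> f' \<and> sign_pattern q (\<epsilon> \<circ> p) f'"
proof -
  \<comment> \<open>The inverse is used because precomposition reverses directions: \<sigma> takes
    pair \<open>p i\<close> to pair i, and the sign read off is
    \<open>\<epsilon> (p i)\<close>.\<close>
  define \<sigma> where "\<sigma> = double_perm q (inv_into UNIV p)"
  have \<sigma>: "\<sigma> permutes {1..n}" unfolding \<sigma>_def by (rule double_perm_permutes[OF permutes_inv[OF p] q])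
  have "sign_pattern q (\<epsilon> \<circ> p) (\<lambda>u. f (u \<circ> \<sigma>))"
    unfolding sign_pattern_def
  proof (intro ballI)
    fix i u assume i: "i \<in> {1..q}" and u: "u \<in> V"
    let ?t = "\<lambda>i. Transposition.transpose (2 * i - 1) (2 * i)"
    have pi: "p i \<in> {1..q}" using permutes_in_image[OF p] i by blast
    have "\<sigma> (2 * p i - 1) = 2 * i - 1" "\<sigma> (2 * p i) = 2 * i"
      unfolding \<sigma>_def double_perm_simps[OF pi] using permutes_inverses[OF p] by auto
    then have "?t i \<circ> \<sigma> = \<sigma> \<circ> ?t (p i)"
      using transpose_comp_bij[OF permutes_inj[OF \<sigma>], of "2 * p i - 1" "2 * p i"] by simp
    then have "f (u \<circ> ?t i \<circ> \<sigma>) = f (u \<circ> \<sigma> \<circ> ?t (p i))" by (simp add: o_assoc[symmetric])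
    also have "\<dots> = \<epsilon> (p i) * f (u \<circ> \<sigma>)" using pt pi comp_in_V[OF u \<sigma>] unfolding sign_pattern_def by blast
    finally show "f (u \<circ> ?t i \<circ> \<sigma>) = (\<epsilon> \<circ> p) i * f (u \<circ> \<sigma>)" by simp
  qed
  then show ?thesis using eigenfunction_comp[OF e \<sigma>] by blast
qed

text \<open>The D antisymmetric pairs are completed by symmetric ones up to q pairs, and permuting
  the pairs places the D negative signs on any prescribed set A.\<close>

lemma high_degree_family:
  assumes e: "eigenfunction \<mu> f" and pt: "sign_pattern D (\<lambda>_. -1) f" and q: "D \<le> q" "2 * q + s \<le> n"
  shows "\<exists>F. \<forall>A\<in>{A. A \<subseteq> {1..q} \<and> card A = D}. eigenfunction \<mu> (F A) \<and> sign_pattern q (\<lambda>i. if i \<in> A then -1 else 1) (F A)"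
proof -
  let ?\<epsilon> = "\<lambda>i. if i \<le> D then -1 else 1 :: real"
  have "\<exists>f. eigenfunction \<mu> f \<and> sign_pattern q' ?\<epsilon> f" if "D \<le> q'" "2 * q' + s \<le> n" for q'
    using that
  proof (induction q' rule: dec_induct)
    case base
    have "sign_pattern D ?\<epsilon> f" using pt unfolding sign_pattern_def by simp
    then show ?case using e by blast
  next
    case (step q')
    then obtain g where "eigenfunction \<mu> g" "sign_pattern q' ?\<epsilon> g" by auto
    then show ?case using sign_pattern_extend_symmetric[of \<mu> g q' ?\<epsilon>] step by auto
  qed
  then obtain g where g: "eigenfunction \<mu> g" "sign_pattern q ?\<epsilon> g" using q by blast
  have "\<exists>f'. eigenfunction \<mu> f' \<and> sign_pattern q (\<lambda>i. if i \<in> A then -1 else 1) f'" if A: "A \<subseteq> {1..q}" "card A = D" for A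
  proof -
    have fA: "finite A" using A(1) finite_subset by blast
    have "card {i \<in> {1..q}. (i \<in> A) = c} = card {i \<in> {1..q}. (i \<le> D) = c}" for c
    proof -
      have 1: "{i \<in> {1..q}. i \<in> A} = A" "{i \<in> {1..q}. i \<notin> A} = {1..q} - A" using A by auto
      have 2: "{i \<in> {1..q}. i \<le> D} = {1..D}" "{i \<in> {1..q}. \<not> i \<le> D} = {1..q} - {1..D}" using q by auto
      show ?thesis
      proof (cases c)
        case True then show ?thesis using 1(1) 2(1) A(2) by simp
      next
        case False
        have "card ({1..q} - A) = card ({1..q} - {1..D})"
          using A q fA by (simp add: card_Diff_subset)
        then show ?thesis using 1(2) 2(2) False by simp
      qed
    qed
    then obtain p where p: "p permutes {1..q}" "\<forall>i\<in>{1..q}. (i \<in> A) = (p i \<le> D)"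
      using equal_fibre_cards_permute[of "{1..q}" "\<lambda>i. i \<in> A" "\<lambda>i. i \<le> D"] by auto
    obtain f' where f': "eigenfunction \<mu> f'" "sign_pattern q (?\<epsilon> \<circ> p) f'"
      using sign_pattern_permute[OF g p(1)] q by auto
    then have "sign_pattern q (\<lambda>i. if i \<in> A then -1 else 1) f'" using p(2) unfolding sign_pattern_def by simp
    then show ?thesis using f' by blast
  qed
  then show ?thesis by (intro bchoice) blast
qed

text \<open>Distinct sets differ in some pair, for which one function is antisymmetric and the other
  symmetric. Exchanging that pair permutes \<open>V\<close> and negates the inner product, so the
  functions are orthogonal, one for each D-subset of the q pairs.\<close>

lemma high_degree_bound:
  assumes e: "eigenfunction \<mu> f" and pt: "sign_pattern D (\<lambda>_. -1) f" and q: "D \<le> q" "2 * q + s \<le> n"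
    and \<epsilon>: "0 < \<epsilon>" and \<mu>: "\<epsilon> * (real n + 1) ^ s\<^sup>2 \<le> \<mu>"
  shows "(q choose D) * (\<mu> - \<epsilon> * (real n + 1) ^ s\<^sup>2)\<^sup>2 \<le> (real m + 1) ^ (2 * s\<^sup>2) / \<epsilon> ^ s"
proof -
  let ?I = "{A. A \<subseteq> {1..q} \<and> card A = D}"
  obtain F where F: "\<And>A. A \<in> ?I \<Longrightarrow> eigenfunction \<mu> (F A)"
    "\<And>A. A \<in> ?I \<Longrightarrow> sign_pattern q (\<lambda>i. if i \<in> A then -1 else 1) (F A)"
    using high_degree_family[OF e pt q] by blast
  have anti: "(\<Sum>v\<in>V. F A v * F A' v) = 0" if AA: "A \<in> ?I" "A' \<in> ?I" "i \<in> A" "i \<notin> A'" for A A' i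
  proof -
    let ?t = "Transposition.transpose (2 * i - 1) (2 * i)"
    have i: "i \<in> {1..q}" using AA by auto
    then have t: "?t permutes {1..n}" using q by (intro transpose_permutes) auto
    have "(\<Sum>v\<in>V. F A v * F A' v) = (\<Sum>v\<in>V. F A (v \<circ> ?t) * F A' (v \<circ> ?t))"
      by (rule sum.reindex_bij_betw[OF bij_comp_V[OF t], symmetric])
    also have "\<dots> = (\<Sum>v\<in>V. - (F A v * F A' v))"
      using F(2)[OF AA(1)] F(2)[OF AA(2)] AA(3,4) i unfolding sign_pattern_def by (intro sum.cong refl) simp
    finally show ?thesis by (simp add: sum_negf)
  qed
  have orth: "(\<Sum>v\<in>V. F A v * F A' v) = 0" if AA: "A \<in> ?I" "A' \<in> ?I" "A \<noteq> A'" for A A'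
  proof -
    consider i where "i \<in> A" "i \<notin> A'" | i where "i \<in> A'" "i \<notin> A" using AA(3) by blast
    then show ?thesis
    proof cases
      case 1 then show ?thesis using anti[OF AA(1,2)] by blast
    next
      case 2 then show ?thesis using anti[OF AA(2,1)] by (simp add: mult.commute)
    qed
  qed
  have "card ?I = q choose D" using n_subsets[of "{1..q}" D] by simp
  moreover have "finite ?I" by (rule finite_subset[of _ "Pow {1..q}"]) auto
  ultimately show ?thesis
    using many_orthogonal_eigenfunctions_bound[where I = ?I and f = F, OF _ F(1) orth \<epsilon> \<mu>] by simp
qed

end

section \<open>The eigenvalue bound\<close>

context balanced_walk begin

lemma two_le_m: "2 \<le> m"
proof -
  have "2 * 1 \<le> s * k" using s_ge k_ge by (intro mult_mono) auto
  then show ?thesis by (simp add: m_def)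
qed

lemma two_le_card_V: "2 \<le> card V"
proof -
  obtain u where u: "u \<in> V" using V_ne by blast
  have "\<not> card S \<le> Suc 0" using card_S s_ge by simp
  then obtain c c' where c: "c \<in> S" "c' \<in> S" "c \<noteq> c'" using card_le_Suc0_iff_eq[OF finite_S] by blast
  have ex: "\<exists>i\<in>{1..n}. u i = d" if "d \<in> S" for d
  proof -
    have "card {i \<in> {1..n}. u i = d} = m" using u that unfolding V_eq balanced_words_def by blast
    then have "{i \<in> {1..n}. u i = d} \<noteq> {}" using m_pos by (metis card.empty less_irrefl)
    then show ?thesis by blast
  qed
  obtain i j where ij: "i \<in> {1..n}" "j \<in> {1..n}" "u i = c" "u j = c'" using ex c by metis
  let ?v = "u \<circ> Transposition.transpose i j"
  have "?v \<in> V" by (rule comp_in_V[OF u transpose_permutes[OF ij(1,2)]])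
  moreover have "?v \<noteq> u" using ij c by (metis comp_apply transpose_apply_first)
  ultimately have "{u, ?v} \<subseteq> V" "card {u, ?v} = 2" using u by (auto simp: card_insert_if)
  then show ?thesis using card_mono[OF finite_V] by metis
qed

lemma lambda2_bound:
  assumes "\<beta> < 1" "\<And>\<mu> f. eigenfunction \<mu> f \<Longrightarrow> \<mu> \<le> \<beta>"
  shows "lambda2 V W \<le> \<beta>"
proof (rule lambda2_le[OF finite_V two_le_card_V symmetric_random_walk assms(1)])
  fix \<mu> :: real and f
  assume "\<exists>u\<in>V. f u \<noteq> 0" "\<And>u. u \<in> V \<Longrightarrow> (\<Sum>v\<in>V. W u v * f v) = \<mu> * f u" "(\<Sum>u\<in>V. f u) = 0"
  then have "eigenfunction \<mu> f" unfolding eigenfunction_def by blast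
  then show "\<bar>\<mu>\<bar> \<le> \<beta>" using assms(2) eigenfunction_nonneg by simp
qed

section \<open>Large n\<close>

text \<open>With threshold \<open>\<epsilon> = 1 / (n (n + 1) ^ s\<^sup>2)\<close> the heavy part has entries at most \<open>n ^ E / card V\<close>, where
  \<open>E = 2 s\<^sup>2 + s + 2 s\<^sup>3\<close>; \<open>D = 2 (E + 2)\<close> makes the binomial coefficient at least \<open>n ^ (E + 2)\<close>.\<close>
lemma high_degree_polynomial_bound:
  assumes e: "eigenfunction \<mu> f" and pt: "sign_pattern D (\<lambda>_. -1) f" and D: "D = 2 * (2 * s\<^sup>2 + s + 2 * s ^ 3 + 2)"
    and n: "64 * D ^ 4 * s ^ 4 \<le> n"
  shows "\<mu> \<le> 2 / n"
proof (cases "\<mu> \<le> 1 / n")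
  case True
  then show ?thesis by (rule order_trans) (simp add: divide_right_mono)
next
  case False
  let ?E = "2 * s\<^sup>2 + s + 2 * s ^ 3"
  define x where "x = real n"
  have D1: "D \<ge> 1" using D by simp
  have D4: "D\<^sup>2 \<le> D ^ 4" using D1 by (intro power_increasing) auto
  have s4: "16 \<le> s ^ 4" "s \<le> s ^ 4" using power_mono[OF s_ge, of 4] power_increasing[of 1 4 s] s_ge by auto
  have n1: "64 * D\<^sup>2 \<le> n"
  proof -
    have "64 * D\<^sup>2 * 1 \<le> 64 * D ^ 4 * s ^ 4" using D4 s4 by (intro mult_mono) auto
    from order_trans[OF this n] show ?thesis by simp
  qed
  have n2: "64 * s \<le> n"
  proof -
    have "64 * 1 * s \<le> 64 * D ^ 4 * s ^ 4" using D1 s4 by (intro mult_mono) auto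
    from order_trans[OF this n] show ?thesis by simp
  qed
  \<comment> \<open>The largest number of disjoint pairs that still leaves s spare positions, as
    required by the pigeonhole extension.\<close>
  define q where "q = (n - s) div 2"
  have q: "2 * q + s \<le> n" "n \<le> 8 * q" using n2 s_ge unfolding q_def by linarith+
  have "D * 1 \<le> D * D" using D1 by (intro mult_left_mono) auto
  then have Dq: "D \<le> q" using q(2) n1 unfolding power2_eq_square by linarith
  have x: "x \<ge> 2" using n2 s_ge unfolding x_def by linarith
  \<comment> \<open>Chosen so that the norm bound for the light part is exactly 1/x; \<mu> exceeds
    it in the present case.\<close>
  define \<epsilon> where "\<epsilon> = 1 / (x * (x + 1) ^ s\<^sup>2)"
  have \<epsilon>: "\<epsilon> > 0" unfolding \<epsilon>_def using x by simp
  have \<delta>: "\<epsilon> * (x + 1) ^ s\<^sup>2 = 1 / x" unfolding \<epsilon>_def using x by (simp add: field_simps)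
  have hd: "(q choose D) * (\<mu> - 1 / x)\<^sup>2 \<le> (real m + 1) ^ (2 * s\<^sup>2) / \<epsilon> ^ s"
    using high_degree_bound[OF e pt Dq q(1) \<epsilon>] False \<delta> unfolding x_def by simp
  have "real m + 1 \<le> x"
  proof -
    have "2 * m \<le> n" unfolding n_eq using s_ge by simp
    then show ?thesis using two_le_m unfolding x_def by linarith
  qed
  then have 1: "(real m + 1) ^ (2 * s\<^sup>2) \<le> x ^ (2 * s\<^sup>2)" by (intro power_mono) auto
  have "x + 1 \<le> x\<^sup>2"
  proof -
    have "x * 2 \<le> x * x" using x by (intro mult_left_mono) auto
    then show ?thesis using x unfolding power2_eq_square by linarith
  qed
  then have "(x + 1) ^ s\<^sup>2 \<le> (x\<^sup>2) ^ s\<^sup>2" using x by (intro power_mono) auto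
  then have "(x * (x + 1) ^ s\<^sup>2) ^ s \<le> (x * (x\<^sup>2) ^ s\<^sup>2) ^ s"
    using x by (intro power_mono[OF mult_left_mono]) auto
  also have "\<dots> = x ^ ((1 + 2 * s\<^sup>2) * s)"
    by (simp only: power_mult power_add power_one_right)
  also have "(1 + 2 * s\<^sup>2) * s = s + 2 * s ^ 3"
    by (simp add: power2_eq_square power3_eq_cube algebra_simps)
  finally have 2: "1 / \<epsilon> ^ s \<le> x ^ (s + 2 * s ^ 3)" unfolding \<epsilon>_def by (simp add: power_divide)
  have "(real m + 1) ^ (2 * s\<^sup>2) * (1 / \<epsilon> ^ s) \<le> x ^ (2 * s\<^sup>2) * x ^ (s + 2 * s ^ 3)"
    using 1 2 x \<epsilon> by (intro mult_mono) auto
  then have up: "(q choose D) * (\<mu> - 1 / x)\<^sup>2 \<le> x ^ ?E" using hd by (simp add: power_add[symmetric] add.assoc)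
  \<comment> \<open>D is even, so x^(E+2) is the D-th power of sqrt x, and n \<ge> 64 D^2 with n
    \<le> 8q gives sqrt x \<le> q/D. The two powers of x beyond E are what turns the estimate into
    x(\<mu> - 1/x) \<le> 1.\<close>
  have "x ^ (?E + 2) = sqrt x ^ D" unfolding D power_mult using x by simp
  also have "\<dots> \<le> (real q / real D) ^ D"
  proof (rule power_mono)
    have "(8 * real D)\<^sup>2 \<le> x" using of_nat_mono[OF n1, where 'a = real] unfolding x_def by (simp add: power_mult_distrib)
    then have "8 * real D \<le> sqrt x" by (rule real_le_rsqrt)
    then have "8 * real D * sqrt x \<le> sqrt x * sqrt x" using x by (intro mult_right_mono) auto
    also have "\<dots> \<le> 8 * real q" using q(2) x of_nat_mono[OF q(2), where 'a = real] unfolding x_def by simp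
    finally show "sqrt x \<le> real q / real D" using D1 by (simp add: field_simps)
  qed (use x in auto)
  also have "\<dots> \<le> real (q choose D)" by (rule binomial_ge_n_over_k_pow_k[OF Dq])
  finally have "x ^ (?E + 2) * (\<mu> - 1 / x)\<^sup>2 \<le> real (q choose D) * (\<mu> - 1 / x)\<^sup>2"
    by (rule mult_right_mono) simp
  with up have "x ^ ?E * (x * (\<mu> - 1 / x))\<^sup>2 \<le> x ^ ?E * 1"
    by (simp add: power_add power_mult_distrib power2_eq_square mult_ac)
  then have "(x * (\<mu> - 1 / x))\<^sup>2 \<le> 1" using x by (subst (asm) mult_le_cancel_left_pos) auto
  then have "x * (\<mu> - 1 / x) \<le> 1" by (simp add: abs_square_le_1)
  then show ?thesis using x unfolding x_def by (simp add: field_simps)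
qed

text \<open>The threshold 64 D^4 s^4 is the square of 8 D^2 s^2, which over n is the low-degree
  bound; above the threshold that bound is at most 1 / sqrt n.\<close>

lemma large_n_bound:
  assumes e: "eigenfunction \<mu> f" and D: "D = 2 * (2 * s\<^sup>2 + s + 2 * s ^ 3 + 2)" and n: "64 * D ^ 4 * s ^ 4 \<le> n"
  shows "\<mu> \<le> 1 / sqrt n"
proof -
  have D1: "D \<ge> 1" using D by simp
  have "1 * 1 * 16 \<le> 64 * D ^ 4 * s ^ 4"
    using D1 power_mono[OF s_ge, of 4] by (intro mult_mono) auto
  from order_trans[OF this n] have n16: "16 \<le> n" by simp
  have 2: "2 * D \<le> n"
  proof -
    have "2 * D * 1 \<le> 64 * D ^ 4 * s ^ 4"
      using D1 s_ge power_increasing[of 1 4 D] by (intro mult_mono) auto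
    from order_trans[OF this n] show ?thesis by simp
  qed
  define x where "x = real n"
  have x: "x \<ge> 16" using n16 unfolding x_def by simp
  have sq: "(8 * real D ^ 2 * real s ^ 2)\<^sup>2 \<le> x"
    using of_nat_mono[OF n, where 'a = real] unfolding x_def
    by (simp add: power_mult_distrib power_mult[symmetric])
  have "2 \<le> sqrt x" using x by (intro real_le_rsqrt) auto
  show ?thesis
  proof (cases "\<exists>f'. eigenfunction \<mu> f' \<and> sign_pattern D (\<lambda>_. -1) f'")
    case True
    then obtain f' where "eigenfunction \<mu> f'" "sign_pattern D (\<lambda>_. -1) f'" by blast
    from high_degree_polynomial_bound[OF this D n] have "\<mu> \<le> 2 / x" unfolding x_def .
    also have "\<dots> \<le> sqrt x / x" using \<open>2 \<le> sqrt x\<close> x by (intro divide_right_mono) auto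
    also have "\<dots> = 1 / sqrt x" using x by (simp add: real_div_sqrt field_simps)
    finally show ?thesis unfolding x_def .
  next
    case False
    \<comment> \<open>The pattern of length 0 holds vacuously and the one of length D is
      unattainable, so there is a last attainable length before a failure.\<close>
    have "\<exists>w<D. (\<exists>f'. eigenfunction \<mu> f' \<and> sign_pattern w (\<lambda>_. -1) f') \<and> \<not> (\<exists>f'. eigenfunction \<mu> f' \<and> sign_pattern (Suc w) (\<lambda>_. -1) f')"
    proof (rule ccontr)
      assume *: "\<not> ?thesis"
      have "\<exists>f'. eigenfunction \<mu> f' \<and> sign_pattern w (\<lambda>_. -1) f'" if "w \<le> D" for w
        using that
      proof (induction w)
        case 0
        then show ?case using e unfolding sign_pattern_def by auto
      next
        case (Suc w)
        then have "w < D" "\<exists>f'. eigenfunction \<mu> f' \<and> sign_pattern w (\<lambda>_. -1) f'" by auto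
        then show ?case using * by blast
      qed
      then show False using False by blast
    qed
    then obtain w f' where w: "w < D" "eigenfunction \<mu> f'" "sign_pattern w (\<lambda>_. -1) f'"
      "\<not> (\<exists>f'. eigenfunction \<mu> f' \<and> sign_pattern (Suc w) (\<lambda>_. -1) f')" by blast
    have "\<bar>\<mu>\<bar> \<le> (2 * real w)\<^sup>2 * (real (s - 1) / real (m - 1))"
      using w 2 by (intro low_degree_bound[OF w(2,3,4)]) auto
    also have "\<dots> \<le> (2 * real D)\<^sup>2 * (2 * real s ^ 2 / x)"
    proof (rule mult_mono)
      have "real (s - 1) / real (m - 1) \<le> real s / (real m / 2)"
        using two_le_m by (intro frac_le) auto
      also have "\<dots> = 2 * real s ^ 2 / x"
        unfolding x_def n_eq using s_ge by (simp add: power2_eq_square)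
      finally show "real (s - 1) / real (m - 1) \<le> 2 * real s ^ 2 / x" .
      show "(2 * real w)\<^sup>2 \<le> (2 * real D)\<^sup>2" using w(1) by (intro power_mono) auto
    qed auto
    also have "\<dots> = 8 * real D ^ 2 * real s ^ 2 / x" by (simp add: power_mult_distrib)
    also have "\<dots> \<le> sqrt x / x" using sq x by (intro divide_right_mono real_le_rsqrt) auto
    also have "\<dots> = 1 / sqrt x" using x by (simp add: real_div_sqrt field_simps)
    finally show ?thesis unfolding x_def by simp
  qed
qed

end

text \<open>The exponent has to precede S in the quantifiers. This works because n, m and the number
  of transpositions per permutation depend only on s and k.\<close>

lemma small_k_bound:
  fixes s k :: nat
  assumes "2 \<le> s" "2 \<le> k"
  shows "\<exists>\<nu>>0. \<forall>(S :: 'a set) \<mu> f. card S = s \<longrightarrow> balanced_walk.eigenfunction S k \<mu> f \<longrightarrow> \<mu> \<le> 1 / real (s\<^sup>2 * k) powr \<nu>"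
proof -
  define n where "n = s\<^sup>2 * k"
  define m where "m = s * k"
  obtain C :: nat where C: "\<And>p (X :: (nat \<Rightarrow> 'a) set) (f :: _ \<Rightarrow> real) (\<eta>::real) u. p permutes {1..n} \<Longrightarrow> 0 \<le> \<eta> \<Longrightarrow>
    (\<And>u q. u \<in> X \<Longrightarrow> q permutes {1..n} \<Longrightarrow> u \<circ> q \<in> X) \<Longrightarrow>
    (\<And>u i j. u \<in> X \<Longrightarrow> i \<in> {1..n} \<Longrightarrow> j \<in> {1..n} \<Longrightarrow> \<bar>f (u \<circ> Transposition.transpose i j) - f u\<bar> \<le> \<eta>) \<Longrightarrow>
    u \<in> X \<Longrightarrow> \<bar>f (u \<circ> p) - f u\<bar> \<le> C * \<eta>"
    using permutes_steps_uniform[of "{1..n}"] by (metis finite_atLeastAtMost)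
  \<comment> \<open>C + 1 replaces C because \<open>spectral_gap\<close> requires a positive
    constant.\<close>
  define X where "X = 8 * (real C + 1)\<^sup>2 * real s ^ (2 * m) * real m ^ n"
  define \<beta> where "\<beta> = 1 - 1 / X"
  have m2: "m \<ge> 1" unfolding m_def using assms by simp
  have n2: "n \<ge> 2" unfolding n_def using assms mult_le_mono[of 1 "s\<^sup>2" 2 k] by simp
  have "1 < X"
  proof -
    have "8 * 1 * 1 * 1 \<le> 8 * (real C + 1)\<^sup>2 * real s ^ (2 * m) * real m ^ n"
      using one_le_power[of "real C + 1" 2] one_le_power[of "real s" "2 * m"] one_le_power[of "real m" n] assms m2
      by (intro mult_mono) auto
    then show ?thesis unfolding X_def by linarith
  qed
  then have \<beta>: "0 < \<beta>" "\<beta> < 1" unfolding \<beta>_def by auto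
  \<comment> \<open>Solves n^(-\<nu>) = \<beta>, turning the constant gap at this single n into a
    power of n.\<close>
  define \<nu> where "\<nu> = - ln \<beta> / ln (real n)"
  have ln: "ln (real n) > 0" using n2 by simp
  have "real n powr \<nu> = 1 / \<beta>"
    unfolding powr_def \<nu>_def using \<beta> n2 ln by (simp add: exp_minus inverse_eq_divide)
  then have eq: "1 / real n powr \<nu> = \<beta>" by simp
  have "\<nu> > 0" unfolding \<nu>_def using \<beta> ln by (intro divide_pos_pos) auto
  moreover have "\<mu> \<le> 1 / real (s\<^sup>2 * k) powr \<nu>" if S: "card S = s" and e: "balanced_walk.eigenfunction S k \<mu> f"
    for S :: "'a set" and \<mu> f
  proof -
    interpret balanced_walk S s k n m
      by unfold_locales (use S assms n_def m_def in auto)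
    have "\<mu> \<le> \<beta>" unfolding \<beta>_def X_def
    proof (rule spectral_gap[OF e assms(2)])
      fix p u and f :: "(nat \<Rightarrow> 'a) \<Rightarrow> real" and \<eta> :: real
      assume a: "p permutes {1..n}" "0 \<le> \<eta>"
        "\<And>u i j. u \<in> V \<Longrightarrow> i \<in> {1..n} \<Longrightarrow> j \<in> {1..n} \<Longrightarrow> \<bar>f (u \<circ> Transposition.transpose i j) - f u\<bar> \<le> \<eta>"
        "u \<in> V"
      have "\<bar>f (u \<circ> p) - f u\<bar> \<le> C * \<eta>" by (rule C[OF a(1,2) comp_in_V a(3,4)])
      also have "\<dots> \<le> (real C + 1) * \<eta>" using a(2) by (intro mult_right_mono) auto
      finally show "\<bar>f (u \<circ> p) - f u\<bar> \<le> (real C + 1) * \<eta>" .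
    qed simp
    then show ?thesis using eq unfolding n_def by simp
  qed
  ultimately show ?thesis by blast
qed

theorem theorem5p9:
  fixes s :: nat
  assumes "s \<ge> 2"
  shows "(\<forall>(S :: 'a set) k. card S = s \<and> k \<ge> 1 \<longrightarrow>
            symmetric_random_walk_matrix (walk_vertices S k) (walk_matrix S k)) \<and>
         (\<exists>\<nu>::real. \<nu> > 0 \<and>
            (\<forall>(S :: 'a set) k. card S = s \<and> k \<ge> 2 \<longrightarrow>
              lambda2 (walk_vertices S k) (walk_matrix S k) \<le> 1 / real (s\<^sup>2 * k) powr \<nu>))"
proof (intro conjI allI impI)
  fix S :: "'a set" and k :: nat assume S: "card S = s \<and> k \<ge> 1"
  interpret balanced_walk S s k "s\<^sup>2 * k" "s * k"
    by unfold_locales (use S assms in auto)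
  show "symmetric_random_walk_matrix (walk_vertices S k) (walk_matrix S k)"
    by (rule symmetric_random_walk)
next
  define D where "D = 2 * (2 * s\<^sup>2 + s + 2 * s ^ 3 + 2)"
  define K where "K = 64 * D ^ 4 * s ^ 4"
  have "\<forall>k\<in>{2..<K}. \<exists>\<nu>>0. \<forall>(S :: 'a set) \<mu> f. card S = s \<longrightarrow> balanced_walk.eigenfunction S k \<mu> f \<longrightarrow>
    \<mu> \<le> 1 / real (s\<^sup>2 * k) powr \<nu>"
    using small_k_bound[OF assms, where 'a = 'a] by simp
  from bchoice[OF this] obtain g where g: "\<And>k. k \<in> {2..<K} \<Longrightarrow> g k > 0"
    "\<And>k (S :: 'a set) \<mu> f. k \<in> {2..<K} \<Longrightarrow> card S = s \<Longrightarrow> balanced_walk.eigenfunction S k \<mu> f \<Longrightarrow>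
      \<mu> \<le> 1 / real (s\<^sup>2 * k) powr g k" by blast
  \<comment> \<open>The value 1/2 serves all k \<ge> K, where n \<ge> k already exceeds the
    threshold; each of the finitely many k below K has its own exponent. Lowering an exponent only
    weakens the bound because n \<ge> 1.\<close>
  define \<nu> where "\<nu> = Min (insert (1/2) (g ` {2..<K}))"
  have "\<nu> > 0" unfolding \<nu>_def using g(1) by (subst Min_gr_iff) auto
  moreover have "lambda2 (walk_vertices S k) (walk_matrix S k) \<le> 1 / real (s\<^sup>2 * k) powr \<nu>"
    if S: "card S = s \<and> k \<ge> 2" for S :: "'a set" and k :: nat
  proof -
    define n where "n = s\<^sup>2 * k"
    interpret balanced_walk S s k n "s * k"
      by unfold_locales (use S assms n_def in auto)
    have n2: "n \<ge> 2" "k \<le> n" unfolding n_def using S assms mult_le_mono[of 1 "s\<^sup>2" 2 k] by auto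
    have mono: "1 / real n powr \<nu>' \<le> 1 / real n powr \<nu>" if "\<nu> \<le> \<nu>'" for \<nu>'
      using that n2 by (intro divide_left_mono powr_mono) auto
    have "lambda2 V W \<le> 1 / real n powr \<nu>"
    proof (rule lambda2_bound)
      show "1 / real n powr \<nu> < 1" using n2 \<open>\<nu> > 0\<close> by (simp add: divide_less_eq_1)
      fix \<mu> f assume e: "eigenfunction \<mu> f"
      show "\<mu> \<le> 1 / real n powr \<nu>"
      proof (cases "k < K")
        case True
        then have "k \<in> {2..<K}" using S by simp
        then have "\<mu> \<le> 1 / real n powr g k" using g(2)[OF _ _ e] S unfolding n_def by blast
        also have "\<dots> \<le> 1 / real n powr \<nu>"
          by (rule mono) (use \<open>k \<in> {2..<K}\<close> in \<open>unfold \<nu>_def, intro Min_le; blast\<close>)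
        finally show ?thesis .
      next
        case False
        then have "64 * D ^ 4 * s ^ 4 \<le> n" using n2 unfolding K_def by simp
        from large_n_bound[OF e D_def this] have "\<mu> \<le> 1 / real n powr (1/2)"
          by (simp add: powr_half_sqrt)
        also have "\<dots> \<le> 1 / real n powr \<nu>" by (rule mono) (unfold \<nu>_def, intro Min_le; simp)
        finally show ?thesis .
      qed
    qed
    then show ?thesis unfolding n_def .
  qed
  ultimately show "\<exists>\<nu>::real. \<nu> > 0 \<and> (\<forall>(S :: 'a set) k. card S = s \<and> k \<ge> 2 \<longrightarrow>
    lambda2 (walk_vertices S k) (walk_matrix S k) \<le> 1 / real (s\<^sup>2 * k) powr \<nu>)" by blast
qed

end
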